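(* There is an absolute constant $c>0$ such that for all sufficiently large $q$ for which an affine plane of order $q$ exists, $$2^{c\, q^{1/2} (\log q)^{3/2}} < I_q < 2^{6q}.$$
   Context: An affine plane of order $q$ is a finite affine plane (point-line incidence structure in which any two points lie on exactly one line, for each point and line not containing it there is exactly one parallel line through the point, and there exist three non-collinear points) with $q^2$ points and $q$ points on each line. A cap in an affine plane is a set of points no three of which are collinear. $I_q$ is the maximum, over all affine planes of order $q$, of the number of caps in the plane (it is defined only when an affine plane of order $q$ exists). Logarithms are base $2$. *)

theory Defs
  imports Complex_Main
begin

text \<open>A line is identified with the set of points on it. No generality is lost: by
  \<open>unique_line\<close>, distinct lines share at most one point, so lines with at least two points are
  determined by their points. Parallel means disjoint.\<close>

locale affine_plane =
  fixes P :: "'a set" and L :: "'a set set"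
  assumes finite_points: "finite P"
    and lines_subset: "\<And>l. l \<in> L \<Longrightarrow> l \<subseteq> P"
    and unique_line: "\<And>x y. x \<in> P \<Longrightarrow> y \<in> P \<Longrightarrow> x \<noteq> y \<Longrightarrow> \<exists>!l. l \<in> L \<and> x \<in> l \<and> y \<in> l"
    and unique_parallel:
      "\<And>x l. x \<in> P \<Longrightarrow> l \<in> L \<Longrightarrow> x \<notin> l \<Longrightarrow> \<exists>!m. m \<in> L \<and> x \<in> m \<and> m \<inter> l = {}"
    and noncollinear_triple: "\<exists>T \<subseteq> P. card T = 3 \<and> \<not> (\<exists>l \<in> L. T \<subseteq> l)"

locale affine_plane_of_order = affine_plane P L
  for P :: "'a set" and L :: "'a set set" and q :: nat +
  assumes card_points: "card P = q\<^sup>2"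
    and card_line: "\<And>l. l \<in> L \<Longrightarrow> card l = q"

definition cap :: "'a set \<Rightarrow> 'a set set \<Rightarrow> 'a set \<Rightarrow> bool" where
  "cap P L S \<longleftrightarrow> S \<subseteq> P \<and> (\<forall>T \<subseteq> S. card T = 3 \<longrightarrow> \<not> (\<exists>l \<in> L. T \<subseteq> l))"

definition num_caps :: "'a set \<Rightarrow> 'a set set \<Rightarrow> nat" where
  "num_caps P L = card {S. cap P L S}"

text \<open>The carrier type of the planes is fixed to \<^typ>\<open>nat\<close>, as a set of planes
  cannot range over all types; \<open>num_caps_le_max_caps\<close> below shows that planes over
  other types contribute nothing new. Unspecified when there is no plane of order \<open>q\<close>.\<close>

definition max_caps :: "nat \<Rightarrow> nat" where
  "max_caps q = Max {num_caps P L | (P :: nat set) L. affine_plane_of_order P L q}"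

lemma num_caps_le:
  assumes "affine_plane_of_order P L q"
  shows "num_caps P L \<le> 2 ^ q\<^sup>2"
proof -
  interpret affine_plane_of_order P L q by fact
  have "card {S. cap P L S} \<le> card (Pow P)"
    by (rule card_mono) (auto simp: finite_points cap_def)
  then show ?thesis
    by (simp add: num_caps_def card_Pow finite_points card_points)
qed

lemma finite_num_caps: "finite {num_caps P L | P L. affine_plane_of_order P L q}"
  by (rule finite_subset[of _ "{..2 ^ q\<^sup>2}"]) (auto simp: num_caps_le)

lemma image_subset_iff_inj:
  assumes "inj_on f P" "A \<subseteq> P" "B \<subseteq> P"
  shows "f ` A \<subseteq> f ` B \<longleftrightarrow> A \<subseteq> B"
proof -
  have "f x \<in> f ` B \<longleftrightarrow> x \<in> B" if "x \<in> A" for x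
    using inj_on_image_mem_iff[OF assms(1) _ assms(3)] that assms(2) by blast
  then show ?thesis by (simp add: image_subset_iff subset_eq[of A])
qed

lemma image_affine_plane_of_order:
  assumes "affine_plane_of_order P L q" and inj: "inj_on f P"
  shows "affine_plane_of_order (f ` P) ((`) f ` L) q"
proof -
  interpret affine_plane_of_order P L q by fact
  have mem: "f x \<in> f ` l \<longleftrightarrow> x \<in> l" if "x \<in> P" "l \<in> L" for x l
    using inj_on_image_mem_iff[OF inj that(1) lines_subset[OF that(2)]] .
  show ?thesis
  proof
    show "finite (f ` P)" using finite_points by simp
    show "card (f ` P) = q\<^sup>2" using card_points inj by (simp add: card_image)
    show "\<And>l. l \<in> (`) f ` L \<Longrightarrow> l \<subseteq> f ` P" using lines_subset by blast
    show "card l = q" if "l \<in> (`) f ` L" for l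
      using that card_line card_image[OF inj_on_subset[OF inj lines_subset]] by auto
  next
    fix x y assume "x \<in> f ` P" "y \<in> f ` P" "x \<noteq> y"
    then obtain a b where ab: "a \<in> P" "b \<in> P" "a \<noteq> b" "x = f a" "y = f b" by auto
    from unique_line[OF ab(1-3)] obtain l where l: "l \<in> L" "a \<in> l" "b \<in> l"
      and u: "\<And>m. m \<in> L \<Longrightarrow> a \<in> m \<Longrightarrow> b \<in> m \<Longrightarrow> m = l" by blast
    show "\<exists>!l. l \<in> (`) f ` L \<and> x \<in> l \<and> y \<in> l"
    proof (rule ex1I[of _ "f ` l"])
      show "f ` l \<in> (`) f ` L \<and> x \<in> f ` l \<and> y \<in> f ` l" using l ab(4,5) by simp
    next
      fix k assume k: "k \<in> (`) f ` L \<and> x \<in> k \<and> y \<in> k"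
      then obtain m where m: "m \<in> L" "k = f ` m" by blast
      with k ab have "a \<in> m" "b \<in> m"
        using mem[OF ab(1) m(1)] mem[OF ab(2) m(1)] by simp_all
      then show "k = f ` l" using u[OF m(1)] m(2) by simp
    qed
  next
    fix x k assume "x \<in> f ` P" "k \<in> (`) f ` L" "x \<notin> k"
    then obtain a l where al: "a \<in> P" "l \<in> L" "a \<notin> l" "x = f a" "k = f ` l" by auto
    have disj: "f ` m \<inter> f ` l = {} \<longleftrightarrow> m \<inter> l = {}" if "m \<in> L" for m
      using inj_on_image_Int[OF inj lines_subset[OF that] lines_subset[OF al(2)]] by auto
    from unique_parallel[OF al(1-3)] obtain m where m: "m \<in> L" "a \<in> m" "m \<inter> l = {}"
      and u: "\<And>n. n \<in> L \<Longrightarrow> a \<in> n \<Longrightarrow> n \<inter> l = {} \<Longrightarrow> n = m" by blast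
    show "\<exists>!m. m \<in> (`) f ` L \<and> x \<in> m \<and> m \<inter> k = {}"
    proof (rule ex1I[of _ "f ` m"])
      show "f ` m \<in> (`) f ` L \<and> x \<in> f ` m \<and> f ` m \<inter> k = {}"
        using m(1,2) disj[OF m(1)] m(3) al(4,5) by simp
    next
      fix k' assume k': "k' \<in> (`) f ` L \<and> x \<in> k' \<and> k' \<inter> k = {}"
      then obtain n where n: "n \<in> L" "k' = f ` n" by blast
      with k' al have "a \<in> n" "n \<inter> l = {}"
        using mem[OF al(1) n(1)] disj[OF n(1)] by simp_all
      then show "k' = f ` m" using u[OF n(1)] n(2) by simp
    qed
  next
    obtain T where T: "T \<subseteq> P" "card T = 3" "\<not> (\<exists>l \<in> L. T \<subseteq> l)"
      using noncollinear_triple by blast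
    show "\<exists>T \<subseteq> f ` P. card T = 3 \<and> \<not> (\<exists>l \<in> (`) f ` L. T \<subseteq> l)"
    proof (intro exI conjI)
      show "f ` T \<subseteq> f ` P" using T by blast
      show "card (f ` T) = 3" using T inj by (simp add: card_image inj_on_subset)
      show "\<not> (\<exists>l \<in> (`) f ` L. f ` T \<subseteq> l)"
        using T(3) image_subset_iff_inj[OF inj T(1) lines_subset] by simp
    qed
  qed
qed

lemma num_caps_image:
  assumes "affine_plane_of_order P L q" and inj: "inj_on f P"
  shows "num_caps (f ` P) ((`) f ` L) = num_caps P L"
proof -
  interpret affine_plane_of_order P L q by fact
  have cap_iff: "cap (f ` P) ((`) f ` L) (f ` S) \<longleftrightarrow> cap P L S" if S: "S \<subseteq> P" for S
  proof -
    have "(card (f ` T) = 3 \<longrightarrow> \<not> (\<exists>l \<in> (`) f ` L. f ` T \<subseteq> l)) \<longleftrightarrow>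
        (card T = 3 \<longrightarrow> \<not> (\<exists>l \<in> L. T \<subseteq> l))" if "T \<subseteq> S" for T
    proof -
      have T: "T \<subseteq> P" using that S by blast
      have "card (f ` T) = card T" using card_image[OF inj_on_subset[OF inj T]] .
      moreover have "(\<exists>l \<in> (`) f ` L. f ` T \<subseteq> l) \<longleftrightarrow> (\<exists>l \<in> L. T \<subseteq> l)"
        using image_subset_iff_inj[OF inj T lines_subset] by simp
      ultimately show ?thesis by simp
    qed
    then have "(\<forall>T \<subseteq> f ` S. card T = 3 \<longrightarrow> \<not> (\<exists>l \<in> (`) f ` L. T \<subseteq> l)) \<longleftrightarrow>
        (\<forall>T \<subseteq> S. card T = 3 \<longrightarrow> \<not> (\<exists>l \<in> L. T \<subseteq> l))"
      unfolding all_subset_image by (rule all_cong)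
    moreover have "f ` S \<subseteq> f ` P" using S by (rule image_mono)
    ultimately show ?thesis
      unfolding cap_def using S by simp
  qed
  have "{S. cap (f ` P) ((`) f ` L) S} = (`) f ` {S. cap P L S}"
  proof (intro set_eqI iffI)
    fix S' assume "S' \<in> {S. cap (f ` P) ((`) f ` L) S}"
    then have cap': "cap (f ` P) ((`) f ` L) S'" by simp
    then obtain S where S: "S \<subseteq> P" "S' = f ` S"
      unfolding cap_def subset_image_iff by blast
    then have "cap P L S" using cap' cap_iff[OF S(1)] by simp
    then show "S' \<in> (`) f ` {S. cap P L S}" using S(2) by blast
  next
    fix S' assume "S' \<in> (`) f ` {S. cap P L S}"
    then obtain S where S: "cap P L S" "S' = f ` S" by blast
    then have "S \<subseteq> P" by (simp add: cap_def)
    then show "S' \<in> {S. cap (f ` P) ((`) f ` L) S}" using S cap_iff by simp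
  qed
  moreover have "inj_on ((`) f) {S. cap P L S}"
    by (rule inj_on_subset[OF inj_on_image_Pow[OF inj]]) (auto simp: cap_def)
  ultimately show ?thesis by (simp add: num_caps_def card_image)
qed

lemma num_caps_le_max_caps:
  fixes P :: "'a set"
  assumes "affine_plane_of_order P L q"
  shows "num_caps P L \<le> max_caps q"
proof -
  interpret affine_plane_of_order P L q by fact
  obtain f :: "'a \<Rightarrow> nat" where inj: "inj_on f P"
    using finite_imp_inj_to_nat_seg[OF finite_points] by blast
  have "num_caps (f ` P) ((`) f ` L)
      \<in> {num_caps P L | (P :: nat set) L. affine_plane_of_order P L q}"
    using image_affine_plane_of_order[OF assms inj] by blast
  then show ?thesis
    unfolding max_caps_def num_caps_image[OF assms inj]
    by (rule Max_ge[OF finite_num_caps])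
qed

end

theory Submission
  imports Defs "HOL-Real_Asymp.Real_Asymp"
begin

text \<open>Upper bound: build a cap greedily. If \<open>S\<close> is the part chosen so far and \<open>A\<close> the set of points that
  can still be added, averaging yields a point \<open>x\<close> of \<open>A\<close> whose lines to the points of \<open>S\<close> contain about
  \<open>|S| |A| / q\<close> points of \<open>A\<close>. Either \<open>x\<close> is discarded, or it is chosen and all these points disappear. Hence
  after \<open>O(sqrt q log q)\<close> choices at most \<open>5(q + 1)\<close> points remain, so there are at most
  \<open>2 powr (5q + o(q))\<close> caps.

  Lower bound: let \<open>N U\<close> be the number of caps inside \<open>U\<close>. For a random point \<open>v\<close>, the ratio
  \<open>N (U \<union> {v}) / N U - 1\<close> is the probability that no secant of a random cap \<open>I\<close> of \<open>U\<close> passes through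
  \<open>v\<close>. If \<open>U\<close> has few collinear triples, then for most \<open>v\<close> the potential secants through \<open>v\<close>
  behave independently, each being present with probability 1/4, and Jensen's inequality bounds this
  probability below by \<open>(3/4) powr (4 E)\<close>, where \<open>E\<close> is the mean number of secants of \<open>I\<close> through \<open>v\<close>.
  While all caps of \<open>U\<close> have at most \<open>s = c sqrt (q log q)\<close> points, \<open>E\<close> is small for most \<open>v\<close>, so \<open>N\<close>
  grows by a factor \<open>1 + q powr (-0.03)\<close> with constant probability. After about \<open>q powr (3/5)\<close> random points \<open>N\<close>
  would exceed the number of sets of at most \<open>s\<close> points. So at least half of all sequences of \<open>m\<close> points,
  \<open>m\<close> about \<open>q powr (3/5)\<close>, contain a cap of \<open>s + 1\<close> points; as each cap lies in few
  sequences, there are at least \<open>(q\<^sup>2 / m) ^ (s + 1) / 2\<close> caps.\<close>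

section \<open>Collinearity, and when a cap can be extended by a point\<close>

context affine_plane_of_order
begin

text \<open>Arguments may coincide: for distinct points \<open>a\<close> and \<open>x\<close> of the
  plane, the \<open>y\<close> with \<open>collinear a x y\<close> form the whole line through them,
  \<open>a\<close> and \<open>x\<close> included. Distinctness is demanded separately where caps are
  concerned.\<close>

definition collinear :: "'a \<Rightarrow> 'a \<Rightarrow> 'a \<Rightarrow> bool" where
  "collinear x y z \<longleftrightarrow> (\<exists>l \<in> L. x \<in> l \<and> y \<in> l \<and> z \<in> l)"

lemma line_unique:
  assumes "l \<in> L" "m \<in> L" "x \<in> l" "y \<in> l" "x \<in> m" "y \<in> m" "x \<noteq> y"
  shows "l = m"
proof -
  have "x \<in> P" "y \<in> P" using assms(1,3,4) lines_subset[OF assms(1)] by auto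
  then show ?thesis using unique_line[of x y] assms by blast
qed

lemma finite_L: "finite L"
  by (rule finite_subset[of _ "Pow P"]) (use lines_subset finite_points in auto)

lemma finite_line: "l \<in> L \<Longrightarrow> finite l"
  by (rule finite_subset[OF lines_subset finite_points])

lemma cap_iff:
  "cap P L S \<longleftrightarrow> S \<subseteq> P \<and>
    (\<forall>x\<in>S. \<forall>y\<in>S. \<forall>z\<in>S. x \<noteq> y \<longrightarrow> y \<noteq> z \<longrightarrow> x \<noteq> z \<longrightarrow> \<not> collinear x y z)"
    (is "?l \<longleftrightarrow> ?r")
proof
  assume l: ?l
  show ?r
  proof (intro conjI ballI impI)
    fix x y z assume xyz: "x \<in> S" "y \<in> S" "z \<in> S" "x \<noteq> y" "y \<noteq> z" "x \<noteq> z"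
    then have "card {x, y, z} = 3" "{x, y, z} \<subseteq> S" by auto
    with l have "\<not> (\<exists>l \<in> L. {x, y, z} \<subseteq> l)" unfolding cap_def by blast
    then show "\<not> collinear x y z" unfolding collinear_def by auto
  qed (use l in \<open>simp add: cap_def\<close>)
next
  assume r: ?r
  show ?l
    unfolding cap_def
  proof (intro conjI allI impI)
    fix T assume T: "T \<subseteq> S" "card T = 3"
    then obtain x y z where xyz: "T = {x, y, z}" "x \<noteq> y" "y \<noteq> z" "x \<noteq> z"
      unfolding card_3_iff by blast
    then have "\<not> collinear x y z" using r T(1) by simp
    then show "\<not> (\<exists>l \<in> L. T \<subseteq> l)"
      unfolding collinear_def xyz(1) by simp
  qed (use r in simp)
qed

lemma cap_mono: "cap P L S \<Longrightarrow> T \<subseteq> S \<Longrightarrow> cap P L T"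
  by (auto simp: cap_def)

lemma cap_empty: "cap P L {}"
  by (simp add: cap_def)

lemma collinear_rev: "collinear x y z \<longleftrightarrow> collinear z y x"
  by (auto simp: collinear_def)

lemma collinear_rotate: "collinear x y z \<longleftrightarrow> collinear y z x"
  by (auto simp: collinear_def)

lemma collinear_perm:
  "collinear x y z \<longleftrightarrow> collinear y x z" "collinear x y z \<longleftrightarrow> collinear x z y"
  by (auto simp: collinear_def)

lemma cap_insert:
  assumes "v \<in> P" "v \<notin> S" "cap P L S"
  shows "cap P L (insert v S) \<longleftrightarrow> (\<forall>x\<in>S. \<forall>y\<in>S. x \<noteq> y \<longrightarrow> \<not> collinear v x y)"
    (is "?l \<longleftrightarrow> ?r")
proof
  assume ?l
  then show ?r using assms(2) unfolding cap_iff by auto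
next
  assume r: ?r
  show ?l
    unfolding cap_iff
  proof (intro conjI ballI impI)
    show "insert v S \<subseteq> P" using assms unfolding cap_iff by blast
    fix x y z assume xyz: "x \<in> insert v S" "y \<in> insert v S" "z \<in> insert v S"
      "x \<noteq> y" "y \<noteq> z" "x \<noteq> z"
    consider "x = v" | "y = v" | "z = v" | "x \<in> S" "y \<in> S" "z \<in> S" using xyz by blast
    then show "\<not> collinear x y z"
    proof cases
      case 1 then show ?thesis using r xyz by auto
    next
      case 2
      then show ?thesis using r xyz collinear_perm(1)[of x y z] by auto
    next
      case 3
      then show ?thesis using r xyz collinear_perm(1)[of z x y] collinear_perm(2)[of x y z]
        by auto
    next
      case 4 then show ?thesis using assms(3) xyz unfolding cap_iff by blast
    qed
  qed
qed

subsection \<open>Containers for caps\<close>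

definition pencil :: "'a \<Rightarrow> 'a set set" where
  "pencil a = {l \<in> L. a \<in> l}"

lemma finite_pencil: "finite (pencil a)"
  using finite_L by (simp add: pencil_def)

lemma pencil_disjoint:
  assumes "l \<in> pencil a" "m \<in> pencil a" "l \<noteq> m"
  shows "(l - {a}) \<inter> (m - {a}) = {}"
proof (rule ccontr)
  assume "\<not> ?thesis"
  then obtain x where "x \<in> l" "x \<in> m" "a \<noteq> x" by auto
  then show False using line_unique[of l m a x] assms by (simp add: pencil_def)
qed

lemma pencil_cover:
  assumes "a \<in> P"
  shows "(\<Union>l\<in>pencil a. l - {a}) = P - {a}"
proof
  show "(\<Union>l\<in>pencil a. l - {a}) \<subseteq> P - {a}"
    using lines_subset by (auto simp: pencil_def)
  show "P - {a} \<subseteq> (\<Union>l\<in>pencil a. l - {a})"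
  proof
    fix x assume x: "x \<in> P - {a}"
    then obtain l where "l \<in> L" "a \<in> l" "x \<in> l" using unique_line[of a x] assms by auto
    then show "x \<in> (\<Union>l\<in>pencil a. l - {a})" using x by (auto simp: pencil_def)
  qed
qed

text \<open>The lines through \<open>a\<close>, with \<open>a\<close> removed, partition the
  remaining points of the plane.\<close>

lemma sum_over_pencil:
  fixes f :: "'a \<Rightarrow> 'b::comm_monoid_add"
  assumes "a \<in> P" "A \<subseteq> P - {a}"
  shows "(\<Sum>x\<in>A. f x) = (\<Sum>l\<in>pencil a. \<Sum>x\<in>A \<inter> l. f x)"
proof -
  have "A = (\<Union>l\<in>pencil a. A \<inter> l)"
    using pencil_cover[OF assms(1)] assms(2) by blast
  then have "(\<Sum>x\<in>A. f x) = (\<Sum>x\<in>(\<Union>l\<in>pencil a. A \<inter> l). f x)" by simp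
  also have "\<dots> = (\<Sum>l\<in>pencil a. \<Sum>x\<in>A \<inter> l. f x)"
  proof (rule sum.UNION_disjoint)
    show "\<forall>l\<in>pencil a. \<forall>m\<in>pencil a. l \<noteq> m \<longrightarrow> A \<inter> l \<inter> (A \<inter> m) = {}"
    proof (intro ballI impI)
      fix l m assume "l \<in> pencil a" "m \<in> pencil a" "l \<noteq> m"
      from pencil_disjoint[OF this] show "A \<inter> l \<inter> (A \<inter> m) = {}" using assms(2) by auto
    qed
  qed (use finite_pencil finite_line in \<open>auto simp: pencil_def\<close>)
  finally show ?thesis .
qed

text \<open>Count the \<open>q\<^sup>2 - 1\<close> points other than \<open>a\<close> line by line,
  \<open>q - 1\<close> on each, and cancel \<open>q - 1\<close>.\<close>

lemma card_pencil:
  assumes "a \<in> P" "q \<ge> 2"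
  shows "card (pencil a) = q + 1"
proof -
  have c: "(\<Sum>x\<in>(P - {a}) \<inter> l. (1::nat)) = q - 1" if "l \<in> pencil a" for l
  proof -
    have l: "l \<in> L" "a \<in> l" using that by (auto simp: pencil_def)
    then have "(P - {a}) \<inter> l = l - {a}" using lines_subset by blast
    then show ?thesis using l card_line finite_line by simp
  qed
  have "q\<^sup>2 - 1 = (\<Sum>x\<in>P - {a}. (1::nat))"
    using assms(1) finite_points by (simp add: card_points)
  also have "\<dots> = (\<Sum>l\<in>pencil a. q - 1)"
    unfolding sum_over_pencil[OF assms(1) subset_refl]
    by (rule sum.cong[OF refl]) (rule c)
  finally have e: "card (pencil a) * (q - 1) = q\<^sup>2 - 1" by simp
  obtain p where p: "q = Suc p" using assms(2) by (cases q) auto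
  have "card (pencil a) * p = (q + 1) * p"
    using e unfolding p by (simp add: power2_eq_square)
  moreover have "p \<noteq> 0" using p assms(2) by auto
  ultimately show ?thesis by (simp only: mult_cancel_right simp_thms)
qed

text \<open>A point \<open>x\<close> on a line \<open>l\<close> through \<open>a\<close> sees
  exactly \<open>A \<inter> l\<close>, so the left side is the sum of the squares of
  \<open>card (A \<inter> l)\<close> over the \<open>q + 1\<close> lines of the pencil.
  Cauchy-Schwarz bounds it from below.\<close>

lemma sum_collinear_ge:
  assumes a: "a \<in> P" and A: "A \<subseteq> P - {a}" and q: "q \<ge> 2"
  shows "(\<Sum>x\<in>A. real (card {y\<in>A. collinear a x y})) \<ge> (real (card A))\<^sup>2 / (real q + 1)"
proof -
  \<comment> \<open>The mean of \<open>card (A \<inter> l)\<close> over the pencil. Summing the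
    nonnegative squares of the deviations from \<open>k\<close> is the proof of Cauchy-Schwarz used
    here.\<close>
  define k where "k = real (card A) / (real q + 1)"
  have eq: "{y\<in>A. collinear a x y} = A \<inter> l" if "l \<in> pencil a" "x \<in> A \<inter> l" for l x
  proof -
    have l: "l \<in> L" "a \<in> l" "x \<in> l" "x \<noteq> a" using that A by (auto simp: pencil_def)
    have "collinear a x y \<longleftrightarrow> y \<in> l" for y
      unfolding collinear_def using l line_unique[of l _ a x] by blast
    then show ?thesis by blast
  qed
  have s: "(\<Sum>l\<in>pencil a. real (card (A \<inter> l))) = real (card A)"
    using sum_over_pencil[OF a A, of "\<lambda>_. 1::real"] by simp
  have "(\<Sum>x\<in>A. real (card {y\<in>A. collinear a x y}))
      = (\<Sum>l\<in>pencil a. \<Sum>x\<in>A \<inter> l. real (card {y\<in>A. collinear a x y}))"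
    by (rule sum_over_pencil[OF a A])
  also have "\<dots> = (\<Sum>l\<in>pencil a. real (card (A \<inter> l)) * real (card (A \<inter> l)))"
    by (rule sum.cong[OF refl]) (simp add: eq)
  also have "\<dots> \<ge> (\<Sum>l\<in>pencil a. 2 * k * real (card (A \<inter> l)) - k\<^sup>2)"
  proof (rule sum_mono)
    fix l
    have "0 \<le> (real (card (A \<inter> l)) - k)\<^sup>2" by simp
    then show "2 * k * real (card (A \<inter> l)) - k\<^sup>2 \<le> real (card (A \<inter> l)) * real (card (A \<inter> l))"
      by (simp add: power2_eq_square algebra_simps)
  qed
  also have "(\<Sum>l\<in>pencil a. 2 * k * real (card (A \<inter> l)) - k\<^sup>2)
      = 2 * k * real (card A) - (real q + 1) * k\<^sup>2"
    using card_pencil[OF a q] s by (simp add: sum_subtractf flip: sum_distrib_left)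
  also have "\<dots> = (real (card A))\<^sup>2 / (real q + 1)"
  proof -
    have "k * (real q + 1) = real (card A)" by (simp add: k_def)
    then have "(real q + 1) * k\<^sup>2 = k * real (card A)" by (simp add: power2_eq_square ac_simps)
    then have "2 * k * real (card A) - (real q + 1) * k\<^sup>2 = k * real (card A)" by simp
    then show ?thesis by (simp add: k_def power2_eq_square)
  qed
  finally show ?thesis .
qed

text \<open>Average over \<open>x\<close> in \<open>A\<close>: after exchanging the two sums, every
  \<open>a\<close> in \<open>S\<close> contributes at least the bound of
  \<open>sum_collinear_ge\<close>.\<close>

lemma exists_rich_point:
  assumes S: "S \<subseteq> P" and A: "A \<subseteq> P - S" "A \<noteq> {}" and q: "q \<ge> 2"
  shows "\<exists>x\<in>A. (\<Sum>a\<in>S. real (card {y\<in>A. collinear a x y}))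
      \<ge> real (card S) * real (card A) / (real q + 1)"
proof (rule ccontr)
  assume "\<not> ?thesis"
  then have less: "(\<Sum>a\<in>S. real (card {y\<in>A. collinear a x y}))
      < real (card S) * real (card A) / (real q + 1)" if "x \<in> A" for x
    using that by force
  have finA: "finite A" using A finite_subset[OF _ finite_points, of A] by auto
  have "(\<Sum>x\<in>A. \<Sum>a\<in>S. real (card {y\<in>A. collinear a x y}))
      < (\<Sum>x\<in>A. real (card S) * real (card A) / (real q + 1))"
    using less finA A(2) by (intro sum_strict_mono) auto
  moreover have "(\<Sum>x\<in>A. \<Sum>a\<in>S. real (card {y\<in>A. collinear a x y}))
      = (\<Sum>a\<in>S. \<Sum>x\<in>A. real (card {y\<in>A. collinear a x y}))"
    by (rule sum.swap)
  moreover have "\<dots> \<ge> (\<Sum>a\<in>S. (real (card A))\<^sup>2 / (real q + 1))"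
    using S A q by (intro sum_mono sum_collinear_ge) auto
  ultimately show False by (simp add: power2_eq_square algebra_simps)
qed

text \<open>The neighbourhoods of \<open>x\<close> on its lines to distinct points of \<open>S\<close> are disjoint because \<open>x\<close>
  lies on no secant of \<open>S\<close>.\<close>

lemma card_uncovered_le:
  assumes S: "S \<subseteq> P" and A: "A \<subseteq> P - S" and x: "x \<in> A" and cap: "cap P L (insert x S)"
    and rich: "(\<Sum>a\<in>S. real (card {y\<in>A. collinear a x y}))
      \<ge> real (card S) * real (card A) / (real q + 1)"
  shows "real (card {y\<in>A - {x}. \<forall>a\<in>S. \<not> collinear a x y})
    \<le> real (card A) - real (card S) * (real (card A) / (real q + 1) - 1)"
proof -
  have fin: "finite A" "finite S" using A S finite_subset[OF _ finite_points] by auto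
  define D where "D a = {y\<in>A. collinear a x y} - {x}" for a
  \<comment> \<open>The point \<open>x\<close> lies on each of its own lines to \<open>S\<close>,
    which costs 1 for every \<open>a\<close>; this is the source of the \<open>- 1\<close> in the
    conclusion.\<close>
  have xin: "x \<in> {y\<in>A. collinear a x y}" if "a \<in> S" for a
    using unique_line[of a x] that x S A unfolding collinear_def by blast
  have cD: "real (card (D a)) = real (card {y\<in>A. collinear a x y}) - 1" if "a \<in> S" for a
  proof -
    have "card {y\<in>A. collinear a x y} = Suc (card (D a))"
      using card.remove[OF _ xin[OF that]] fin by (auto simp: D_def)
    then show ?thesis by simp
  qed
  have disj: "D a \<inter> D b = {}" if ab: "a \<in> S" "b \<in> S" "a \<noteq> b" for a b
  proof (rule ccontr)
    assume "D a \<inter> D b \<noteq> {}"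
    then obtain y where y: "y \<noteq> x" "collinear a x y" "collinear b x y" by (auto simp: D_def)
    then have "collinear a b x"
      unfolding collinear_def using line_unique[of _ _ x y] by blast
    moreover have "a \<noteq> x" "b \<noteq> x" using x A ab by auto
    ultimately show False using cap ab unfolding cap_iff by blast
  qed
  have "card (\<Union>a\<in>S. D a) = (\<Sum>a\<in>S. card (D a))"
    using fin disj by (intro card_UN_disjoint) (auto simp: D_def)
  then have u: "real (card (\<Union>a\<in>S. D a))
      = (\<Sum>a\<in>S. real (card {y\<in>A. collinear a x y})) - real (card S)"
    using cD by (simp add: sum_subtractf)
  have "{y\<in>A - {x}. \<forall>a\<in>S. \<not> collinear a x y} \<subseteq> A - (\<Union>a\<in>S. D a)"
    by (auto simp: D_def)
  then have "card {y\<in>A - {x}. \<forall>a\<in>S. \<not> collinear a x y} \<le> card (A - (\<Union>a\<in>S. D a))"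
    using fin by (intro card_mono) auto
  also have "\<dots> = card A - card (\<Union>a\<in>S. D a)"
    using fin by (intro card_Diff_subset) (auto simp: D_def)
  finally have le: "card {y\<in>A - {x}. \<forall>a\<in>S. \<not> collinear a x y} \<le> card A - card (\<Union>a\<in>S. D a)" .
  have "card (\<Union>a\<in>S. D a) \<le> card A"
    using fin by (intro card_mono) (auto simp: D_def)
  with le have "real (card {y\<in>A - {x}. \<forall>a\<in>S. \<not> collinear a x y})
      \<le> real (card A) - real (card (\<Union>a\<in>S. D a))" by linarith
  then show ?thesis using u rich by (simp add: algebra_simps)
qed

section \<open>Counting the branches of the greedy construction\<close>

text \<open>A state of the construction: \<open>S\<close> is already chosen, \<open>A\<close> is
  still available, and the members are the possible sets of later choices.\<close>

definition extensions :: "'a set \<Rightarrow> 'a set \<Rightarrow> 'a set set" where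
  "extensions S A = {J. J \<subseteq> A \<and> cap P L (S \<union> J)}"

text \<open>Branch on whether \<open>x\<close> is chosen. If it is, the cap property forbids every
  further point on a line from \<open>x\<close> to a point of \<open>S\<close>.\<close>

lemma card_extensions_le:
  assumes "finite A" "x \<in> A" "A \<inter> S = {}"
  shows "card (extensions S A) \<le> card (extensions S (A - {x}))
    + card (extensions (insert x S) {y\<in>A - {x}. \<forall>a\<in>S. \<not> collinear a x y})"
    (is "_ \<le> _ + card (extensions _ ?A')")
proof -
  have fin: "finite (extensions T B)" if "finite B" for T B
    by (rule finite_subset[of _ "Pow B"]) (use that in \<open>auto simp: extensions_def\<close>)
  have "extensions S A \<subseteq> extensions S (A - {x}) \<union> insert x ` extensions (insert x S) ?A'"
  proof
    fix J assume J: "J \<in> extensions S A"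
    show "J \<in> extensions S (A - {x}) \<union> insert x ` extensions (insert x S) ?A'"
    proof (cases "x \<in> J")
      case True
      have "\<not> collinear a x y" if "y \<in> J - {x}" "a \<in> S" for a y
        
      proof -
        have "cap P L (S \<union> J)" using J by (simp add: extensions_def)
        moreover have "a \<in> S \<union> J" "x \<in> S \<union> J" "y \<in> S \<union> J" "a \<noteq> x" "x \<noteq> y" "a \<noteq> y"
          using J True that assms(2,3) by (auto simp: extensions_def)
        ultimately show ?thesis unfolding cap_iff by blast
      qed
      then have "J - {x} \<subseteq> ?A'" using J by (auto simp: extensions_def)
      moreover have "insert x S \<union> (J - {x}) = S \<union> J" using True by blast
      ultimately have "J - {x} \<in> extensions (insert x S) ?A'"
        using J by (simp add: extensions_def)
      moreover have "J = insert x (J - {x})" using True by blast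
      ultimately show ?thesis by blast
    next
      case False
      then show ?thesis using J by (auto simp: extensions_def)
    qed
  qed
  then have "card (extensions S A)
      \<le> card (extensions S (A - {x}) \<union> insert x ` extensions (insert x S) ?A')"
    using fin assms(1) by (intro card_mono) auto
  also have "\<dots> \<le> card (extensions S (A - {x})) + card (insert x ` extensions (insert x S) ?A')"
    by (rule card_Un_le)
  also have "card (insert x ` extensions (insert x S) ?A') \<le> card (extensions (insert x S) ?A')"
    using fin assms(1) by (intro card_image_le) auto
  finally show ?thesis by simp
qed

text \<open>The exponent \<open>j + (r - card S)\<close> is a budget for the choices still to come.
  The first \<open>r\<close> choices are paid from \<open>r - card S\<close>, which truncates to 0
  afterwards. Each later choice shrinks \<open>A\<close> by the factor \<open>1 - \<alpha>\<close>
  and is paid from \<open>j\<close>. Rejected points cost nothing but still shrink \<open>A\<close>,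
  hence the induction on \<open>card A\<close>. Once \<open>card A \<le> B\<close>, all subsets of
  \<open>A\<close> are counted.\<close>

lemma card_extensions_bound:
  fixes r :: nat
  defines "\<alpha> \<equiv> 4 / 5 * real r / (real q + 1)" and "B \<equiv> 5 * (q + 1)"
  assumes q: "q \<ge> 2" and r: "r \<le> q"
    and "S \<subseteq> P" "A \<subseteq> P - S" "\<And>x. x \<in> A \<Longrightarrow> cap P L (insert x S)"
    and "real (card A) * (1 - \<alpha>) ^ j \<le> real B"
  shows "card (extensions S A) \<le> 2 ^ B * (1 + card A) ^ (j + (r - card S))"
  using assms(5-)
proof (induction "card A" arbitrary: A S j rule: less_induct)
  case less
  have "A \<subseteq> P" using less.prems(2) by blast
  then have fin: "finite A" "finite S"
    using less.prems(1) by (auto intro: finite_subset[OF _ finite_points])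
  have \<alpha>: "0 \<le> \<alpha>" "\<alpha> \<le> 1"
    unfolding \<alpha>_def using r by (simp_all add: divide_le_eq)
  show ?case
  proof (cases "card A \<le> B")
    case True
    have "card (extensions S A) \<le> card (Pow A)"
      using fin by (intro card_mono) (auto simp: extensions_def)
    also have "\<dots> \<le> 2 ^ B" using fin True by (simp add: card_Pow)
    also have "\<dots> \<le> 2 ^ B * (1 + card A) ^ (j + (r - card S))" by simp
    finally show ?thesis .
  next
    case False
    then have "A \<noteq> {}" by auto
    then obtain x where x: "x \<in> A" and rich: "(\<Sum>a\<in>S. real (card {y\<in>A. collinear a x y}))
      \<ge> real (card S) * real (card A) / (real q + 1)"
      using exists_rich_point[OF less.prems(1,2) _ q] by blast
    define A' where "A' = {y\<in>A - {x}. \<forall>a\<in>S. \<not> collinear a x y}"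
    have AS: "A \<inter> S = {}" using less.prems(2) by blast
    have xS: "x \<notin> S" using x AS by blast
    have cA: "card (A - {x}) < card A" by (rule card_Diff1_less[OF fin(1) x])
    have "A' \<subseteq> A - {x}" by (auto simp: A'_def)
    then have "card A' \<le> card (A - {x})" using fin by (intro card_mono) auto
    then have cA': "card A' < card A" using cA by simp
    define e where "e = j + (r - card S)"
    have *: "real (card (A - {x})) * (1 - \<alpha>) ^ j \<le> real B"
    proof -
      have "real (card (A - {x})) * (1 - \<alpha>) ^ j \<le> real (card A) * (1 - \<alpha>) ^ j"
        using cA \<alpha> by (intro mult_right_mono) auto
      then show ?thesis using less.prems(4) by linarith
    qed
    have 1: "card (extensions S (A - {x})) \<le> 2 ^ B * (1 + card (A - {x})) ^ e"
      unfolding e_def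
      using less.hyps[OF cA, of S j] less.prems(1-3) * by auto
    \<comment> \<open>Choosing \<open>x\<close> spends one unit of the budget. That a unit is left
      must be proved as well, since \<open>e - 1\<close> is truncated.\<close>
    have "e \<ge> 1 \<and> card (extensions (insert x S) A') \<le> 2 ^ B * (1 + card A') ^ (e - 1)"
    proof -
      have capS: "cap P L (insert y (insert x S))" if "y \<in> A'" for y
      proof -
        have y: "y \<in> A" "y \<noteq> x" "\<And>a. a \<in> S \<Longrightarrow> \<not> collinear a x y"
          using that by (auto simp: A'_def)
        have *: "\<not> collinear y a b" if ab: "a \<in> insert x S" "b \<in> insert x S" "a \<noteq> b" for a b
        proof -
          have yS: "\<not> collinear y a b" if "a \<in> S" "b \<in> S" "a \<noteq> b" for a b
          proof -
            have "y \<in> P" "y \<notin> S" using y(1) AS less.prems(2) by auto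
            from cap_insert[OF this cap_mono[OF less.prems(3)[OF x] subset_insertI]] show ?thesis
              using less.prems(3)[OF y(1)] that by simp
          qed
          consider "a \<in> S" "b \<in> S" | "a = x" "b \<in> S" | "a \<in> S" "b = x"
            using ab by blast
          then show ?thesis
          proof cases
            case 1 then show ?thesis using yS ab(3) by blast
          next
            case 2 then show ?thesis using y(3)[of b] collinear_rev[of y x b] by simp
          next
            case 3 then show ?thesis using y(3)[of a] collinear_rotate[of y a x] by simp
          qed
        qed
        show ?thesis
        proof -
          have "y \<in> P" "y \<notin> insert x S" using y AS less.prems(2) by auto
          from cap_insert[OF this less.prems(3)[OF x]] show ?thesis using * by simp
        qed
      qed
      have A'sub: "A' \<subseteq> P - insert x S" using less.prems(2) by (auto simp: A'_def)
      have Ssub: "insert x S \<subseteq> P" using less.prems(1,2) x by blast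
      have cS: "card (insert x S) = Suc (card S)" using fin xS by simp
      show ?thesis
      proof (cases "card S < r")
        case True
        have "real (card A') * (1 - \<alpha>) ^ j \<le> real (card A) * (1 - \<alpha>) ^ j"
          using cA' \<alpha>(2) by (intro mult_right_mono) auto
        then have "real (card A') * (1 - \<alpha>) ^ j \<le> real B" using less.prems(4) by linarith
        from less.hyps[OF cA' Ssub A'sub capS this]
        have "card (extensions (insert x S) A') \<le> 2 ^ B * (1 + card A') ^ (j + (r - Suc (card S)))"
          by (simp add: cS)
        moreover have "e - 1 = j + (r - Suc (card S))" "e \<ge> 1"
          using True by (auto simp: e_def)
        ultimately show ?thesis by simp
      next
        case False
        \<comment> \<open>With \<open>j = 0\<close> the shrinking hypothesis would read
          \<open>card A \<le> B\<close>.\<close>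
        have "j \<noteq> 0"
        proof
          assume "j = 0"
          then show False using less.prems(4) \<open>\<not> card A \<le> B\<close> by simp
        qed
        then obtain i where i: "j = Suc i" by (cases j) auto
        have "real (card A') \<le> real (card A) - real (card S) * (real (card A) / (real q + 1) - 1)"
          unfolding A'_def
          by (rule card_uncovered_le[OF less.prems(1,2) x less.prems(3)[OF x] rich])
        also have "\<dots> \<le> real (card A) - real r * (4 / 5 * (real (card A) / (real q + 1)))"
        proof -
          have "real (card A) > 5 * (real q + 1)"
          proof -
            have "real (5 * (q + 1)) < real (card A)"
              using \<open>\<not> card A \<le> B\<close> by (simp only: of_nat_less_iff B_def not_le)
            then show ?thesis by simp
          qed
          then have "real (card A) / (real q + 1) \<ge> 5"
            by (subst pos_le_divide_eq) auto
          \<comment> \<open>For t >= 5 one has t - 1 >= 4t/5. This is why the process stops at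
            \<open>B = 5 * (q + 1)\<close>, and where the 4/5 in \<open>\<alpha>\<close> comes
            from.\<close>
          then have "4 / 5 * (real (card A) / (real q + 1)) \<le> real (card A) / (real q + 1) - 1"
            by linarith
          moreover have "real r \<le> real (card S)" using False by simp
          ultimately have "real r * (4 / 5 * (real (card A) / (real q + 1)))
              \<le> real (card S) * (real (card A) / (real q + 1) - 1)"
            by (intro mult_mono) (auto intro: order_trans[rotated])
          then show ?thesis by simp
        qed
        also have "\<dots> = real (card A) * (1 - \<alpha>)" by (simp add: \<alpha>_def field_simps)
        finally have "real (card A') * (1 - \<alpha>) ^ i \<le> real (card A) * (1 - \<alpha>) * (1 - \<alpha>) ^ i"
          using \<alpha> by (intro mult_right_mono) auto
        also have "\<dots> \<le> real B" using less.prems(4) by (simp add: i mult.assoc)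
        finally have "real (card A') * (1 - \<alpha>) ^ i \<le> real B" .
        from less.hyps[OF cA' Ssub A'sub capS this]
        have "card (extensions (insert x S) A') \<le> 2 ^ B * (1 + card A') ^ (i + (r - Suc (card S)))"
          by (simp add: cS)
        then show ?thesis using False by (simp add: e_def i)
      qed
    qed
    then obtain d where d: "e = Suc d"
      and 2: "card (extensions (insert x S) A') \<le> 2 ^ B * (1 + card A') ^ d"
      by (cases e) auto
    have "card (extensions S A) \<le> 2 ^ B * (1 + card (A - {x})) ^ e + 2 ^ B * (1 + card A') ^ d"
      using card_extensions_le[OF fin(1) x AS] 1 2 unfolding A'_def by linarith
    \<comment> \<open>With a = \<open>card A\<close>, the two branches recombine as a^(d+1) + a^d =
      (1 + a) a^d, which is at most (1 + a)^(d+1); the base \<open>1 + card A\<close> is chosen for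
      this.\<close>
    also have "\<dots> \<le> 2 ^ B * card A ^ e + 2 ^ B * card A ^ d"
      using cA cA' by (intro add_mono mult_left_mono power_mono) auto
    also have "\<dots> = 2 ^ B * ((1 + card A) * card A ^ d)" by (simp add: d algebra_simps)
    also have "\<dots> \<le> 2 ^ B * ((1 + card A) * (1 + card A) ^ d)"
      by (intro mult_left_mono power_mono) auto
    finally show ?thesis by (simp add: d flip: e_def)
  qed
qed

lemma num_caps_bound:
  assumes "q \<ge> 2" "r \<le> q"
    and "(real q)\<^sup>2 * (1 - 4 / 5 * real r / (real q + 1)) ^ j \<le> 5 * (real q + 1)"
  shows "num_caps P L \<le> 2 ^ (5 * (q + 1)) * (1 + q\<^sup>2) ^ (j + r)"
proof -
  have "cap P L {x}" if "x \<in> P" for x using that by (simp add: cap_iff)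
  moreover have "{S. cap P L S} = extensions {} P" by (auto simp: extensions_def cap_def)
  ultimately show ?thesis
    using card_extensions_bound[of r "{}" P j] assms
    by (simp add: num_caps_def card_points)
qed

end

section \<open>Asymptotic form of the upper bound\<close>

text \<open>Take \<open>r\<close> about sqrt q, so that \<open>\<alpha>\<close> is at least 1/(2
  sqrt q). Then \<open>j\<close> about 2 sqrt q ln q further choices reduce the q^2 points by a
  factor 1/q, leaving fewer than \<open>5 * (q + 1)\<close>.\<close>

lemma num_caps_upper:
  "eventually (\<lambda>q. \<forall>(P :: 'a set) L. affine_plane_of_order P L q \<longrightarrow>
     real (num_caps P L) < 2 powr (6 * real q)) sequentially"
proof -
  \<comment> \<open>The \<open>j + r\<close> factors \<open>1 + q\<^sup>2\<close> contribute O(sqrt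
    q (log q)^2) to the exponent, which fits into the gap between 5q and 6q.\<close>
  have ev: "eventually (\<lambda>q::nat. 5 * (real q + 1) + (2 * sqrt q * ln q + 1 + sqrt q + 1)
      * log 2 (1 + (real q)\<^sup>2) < 6 * real q) sequentially"
    by real_asymp
  show ?thesis
    using ev eventually_ge_at_top[of 4]
  proof eventually_elim
    case (elim q)
    show ?case
    proof (intro allI impI)
      fix P :: "'a set" and L
      assume "affine_plane_of_order P L q"
      then interpret affine_plane_of_order P L q .
      define r where "r = nat \<lceil>sqrt q\<rceil>"
      define j where "j = nat \<lceil>2 * sqrt q * ln q\<rceil>"
      have q: "real q \<ge> 4" using elim by simp
      have lnq: "ln (real q) \<ge> 0" using q by simp
      have r: "real r \<ge> sqrt q" "real r \<le> sqrt q + 1"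
        using real_sqrt_ge_zero[of q] unfolding r_def by linarith+
      have "0 \<le> 2 * sqrt q * ln q" using lnq by simp
      then have j: "real j \<ge> 2 * sqrt q * ln q" "real j \<le> 2 * sqrt q * ln q + 1"
        unfolding j_def by linarith+
      have sq: "sqrt q \<ge> 2" using q real_le_rsqrt[of 2 "real q"] by simp
      have sqq: "sqrt q * sqrt q = q" by simp
      have "2 * sqrt q \<le> sqrt q * sqrt q" using sq by (intro mult_right_mono) auto
      then have "sqrt q + 1 \<le> real q" using sq sqq by linarith
      then have rq: "r \<le> q" using r by linarith
      define \<alpha> where "\<alpha> = 4 / 5 * real r / (real q + 1)"
      have \<alpha>1: "\<alpha> \<le> 1" using rq by (simp add: \<alpha>_def field_simps)
      have "1 / (2 * sqrt q) \<le> 4 / 5 * sqrt q / (real q + 1)"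
      proof -
        have "real q + 1 \<le> 4 / 5 * sqrt q * (2 * sqrt q)" using q by (simp add: mult.commute)
        then have "(real q + 1) / (2 * sqrt q) \<le> 4 / 5 * sqrt q"
          using sq by (subst pos_divide_le_eq) auto
        then have "1 / (2 * sqrt q) * (real q + 1) \<le> 4 / 5 * sqrt q" by simp
        then show ?thesis by (subst pos_le_divide_eq) auto
      qed
      also have "\<dots> \<le> \<alpha>" unfolding \<alpha>_def using r by (intro divide_right_mono) auto
      finally have \<alpha>: "1 / (2 * sqrt q) \<le> \<alpha>" .
      have "(1 - \<alpha>) ^ j \<le> exp (- \<alpha>) ^ j"
        using \<alpha>1 exp_ge_add_one_self[of "- \<alpha>"] by (intro power_mono) auto
      also have "\<dots> = exp (- (real j * \<alpha>))" by (simp flip: exp_of_nat_mult)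
      also have "\<dots> \<le> exp (- ln q)"
      proof -
        have "ln q = (2 * sqrt q * ln q) * (1 / (2 * sqrt q))" using q by simp
        also have "\<dots> \<le> real j * \<alpha>" using j \<alpha> lnq by (intro mult_mono) auto
        finally show ?thesis by simp
      qed
      also have "\<dots> = 1 / q" using q by (simp add: exp_minus field_simps)
      finally have "(real q)\<^sup>2 * (1 - \<alpha>) ^ j \<le> (real q)\<^sup>2 * (1 / q)"
        by (intro mult_left_mono) auto
      also have "\<dots> \<le> 5 * (real q + 1)" using q by (simp add: power2_eq_square)
      finally have "num_caps P L \<le> 2 ^ (5 * (q + 1)) * (1 + q\<^sup>2) ^ (j + r)"
        using rq elim unfolding \<alpha>_def by (intro num_caps_bound) auto
      then have "real (num_caps P L) \<le> 2 ^ (5 * (q + 1)) * (1 + (real q)\<^sup>2) ^ (j + r)"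
        by (simp flip: of_nat_le_iff[where 'a=real])
      also have "\<dots> = 2 powr (5 * (real q + 1) + real (j + r) * log 2 (1 + (real q)\<^sup>2))"
      proof -
        have pos: "1 + (real q)\<^sup>2 > 0" by (simp add: add_pos_nonneg)
        have "(1 + (real q)\<^sup>2) ^ (j + r) = (2 powr log 2 (1 + (real q)\<^sup>2)) powr real (j + r)"
          using pos by (simp add: powr_realpow del: of_nat_add)
        moreover have "(2::real) ^ (5 * (q + 1)) = 2 powr (5 * (real q + 1))"
          by (simp add: algebra_simps flip: powr_realpow)
        ultimately show ?thesis by (simp only: powr_add powr_powr mult.commute)
      qed
      also have "\<dots> < 2 powr (6 * real q)"
      proof -
        have "real (j + r) * log 2 (1 + (real q)\<^sup>2)
            \<le> (2 * sqrt q * ln q + 1 + sqrt q + 1) * log 2 (1 + (real q)\<^sup>2)"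
          using r j by (intro mult_right_mono) (auto simp: add_pos_nonneg)
        then show ?thesis using elim by simp
      qed
      finally show "real (num_caps P L) < 2 powr (6 * real q)" .
    qed
  qed
qed

subsection \<open>Secants of a random cap\<close>

lemma card_supersets:
  assumes "finite A" "e \<subseteq> A" "card e = 2"
  shows "4 * card {J. e \<subseteq> J \<and> J \<subseteq> A} = 2 ^ card A"
proof -
  have "finite e" using assms finite_subset by blast
  have "{J. e \<subseteq> J \<and> J \<subseteq> A} = (\<union>) e ` Pow (A - e)"
  proof (intro equalityI subsetI)
    fix J assume "J \<in> {J. e \<subseteq> J \<and> J \<subseteq> A}"
    then have "J = e \<union> (J - e)" "J - e \<in> Pow (A - e)" by auto
    then show "J \<in> (\<union>) e ` Pow (A - e)" by blast
  qed (use assms in auto)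
  moreover have "inj_on ((\<union>) e) (Pow (A - e))" by (auto simp: inj_on_def)
  ultimately have "card {J. e \<subseteq> J \<and> J \<subseteq> A} = 2 ^ card (A - e)"
    using assms(1) by (simp add: card_image card_Pow)
  moreover have "card A = card (A - e) + 2"
    using assms \<open>finite e\<close> card_mono[OF assms(1,2)] by (simp add: card_Diff_subset)
  ultimately show ?thesis by simp
qed

text \<open>Linearity of expectation for a uniformly random subset of \<open>A\<close>: a given pair
  is contained in it with probability 1/4. The factor 4 is moved to the left to stay in the natural
  numbers.\<close>

lemma sum_card_contained_pairs:
  assumes "finite A" "finite F" "\<And>e. e \<in> F \<Longrightarrow> e \<subseteq> A \<and> card e = 2"
  shows "4 * (\<Sum>J\<in>Pow A. card {e\<in>F. e \<subseteq> J}) = card F * 2 ^ card A"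
proof -
  have "(\<Sum>J\<in>Pow A. card {e\<in>F. e \<subseteq> J}) = (\<Sum>J\<in>Pow A. \<Sum>e\<in>F. if e \<subseteq> J then 1 else 0)"
    using assms(2) by (simp add: sum.If_cases Int_def)
  also have "\<dots> = (\<Sum>e\<in>F. \<Sum>J\<in>Pow A. if e \<subseteq> J then 1 else 0)"
    by (rule sum.swap)
  also have "\<dots> = (\<Sum>e\<in>F. card {J. e \<subseteq> J \<and> J \<subseteq> A})"
  proof (rule sum.cong[OF refl])
    fix e
    have "Pow A \<inter> {J. e \<subseteq> J} = {J. e \<subseteq> J \<and> J \<subseteq> A}" by auto
    then show "(\<Sum>J\<in>Pow A. if e \<subseteq> J then 1 else 0) = card {J. e \<subseteq> J \<and> J \<subseteq> A}"
      using assms(1) by (simp add: sum.If_cases)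
  qed
  finally have "4 * (\<Sum>J\<in>Pow A. card {e\<in>F. e \<subseteq> J}) = (\<Sum>e\<in>F. 4 * card {J. e \<subseteq> J \<and> J \<subseteq> A})"
    by (simp add: sum_distrib_left)
  also have "\<dots> = (\<Sum>e\<in>F. 2 ^ card A)"
  proof (rule sum.cong[OF refl])
    fix e assume "e \<in> F"
    then show "4 * card {J. e \<subseteq> J \<and> J \<subseteq> A} = 2 ^ card A"
      using assms(3) by (intro card_supersets[OF assms(1)]) auto
  qed
  finally show ?thesis by simp
qed

text \<open>For disjoint pairs the events of being contained in a random subset are independent, so
  all are avoided with probability (3/4)^|F|. The induction splits off one pair \<open>e\<close>, on
  which three of the four traces are allowed.\<close>

lemma card_avoiding_pairs:
  assumes "finite F" "finite A" "\<And>e. e \<in> F \<Longrightarrow> e \<subseteq> A \<and> card e = 2"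
    and "\<And>e f. e \<in> F \<Longrightarrow> f \<in> F \<Longrightarrow> e \<noteq> f \<Longrightarrow> e \<inter> f = {}"
  shows "3 ^ card F * 2 ^ card A \<le> 4 ^ card F * card {J. J \<subseteq> A \<and> (\<forall>e\<in>F. \<not> e \<subseteq> J)}"
  using assms
proof (induction F arbitrary: A rule: finite_induct)
  case empty
  have "{J. J \<subseteq> A \<and> (\<forall>e\<in>{}. \<not> e \<subseteq> J)} = Pow A" by auto
  then show ?case using empty by (simp add: card_Pow)
next
  case (insert e F)
  define B where "B = A - e"
  define X where "X = {J. J \<subseteq> B \<and> (\<forall>f\<in>F. \<not> f \<subseteq> J)}"
  define Y where "Y = Pow e - {e}"
  have e: "e \<subseteq> A" "card e = 2" "finite e"
    using insert.prems(2)[of e] insert.prems(1) finite_subset by auto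
  have FB: "f \<subseteq> B \<and> card f = 2" if "f \<in> F" for f
    using insert.prems(2)[of f] insert.prems(3)[of e f] insert.hyps that
    by (auto simp: B_def)
  have finB: "finite B" using insert.prems(1) by (simp add: B_def)
  have finX: "finite X"
    by (rule finite_subset[of _ "Pow B"]) (use finB in \<open>auto simp: X_def\<close>)
  have cA: "card A = card B + 2"
    using insert.prems(1) e card_mono[OF insert.prems(1) e(1)]
    by (simp add: B_def card_Diff_subset)
  have cY: "card Y = 3" using e by (simp add: Y_def card_Pow)
  have IH: "3 ^ card F * 2 ^ card B \<le> 4 ^ card F * card X"
    unfolding X_def
  proof (rule insert.IH[OF finB FB])
    show "f \<inter> g = {}" if "f \<in> F" "g \<in> F" "f \<noteq> g" for f g
      using insert.prems(3)[of f g] that by simp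
  qed
  have inj: "inj_on (\<lambda>(K, J). K \<union> J) (Y \<times> X)"
  proof (rule inj_onI, clarify)
    fix K J K' J' assume kj: "K \<in> Y" "J \<in> X" "K' \<in> Y" "J' \<in> X" and eq: "K \<union> J = K' \<union> J'"
    have "K = (K \<union> J) \<inter> e" "K' = (K' \<union> J') \<inter> e" "J = (K \<union> J) - e" "J' = (K' \<union> J') - e"
      using kj by (auto simp: X_def Y_def B_def)
    then show "K = K' \<and> J = J'" using eq by metis
  qed
  have sub: "(\<lambda>(K, J). K \<union> J) ` (Y \<times> X) \<subseteq> {J. J \<subseteq> A \<and> (\<forall>f\<in>insert e F. \<not> f \<subseteq> J)}"
  proof (clarify, intro conjI ballI)
    fix K J assume kj: "K \<in> Y" "J \<in> X"
    show "K \<union> J \<subseteq> A" using kj e by (auto simp: X_def Y_def B_def)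
    fix f assume f: "f \<in> insert e F"
    show "\<not> f \<subseteq> K \<union> J"
    proof (cases "f = e")
      case True
      then show ?thesis using kj by (auto simp: X_def Y_def B_def)
    next
      case False
      then have "f \<in> F" using f by simp
      then have "\<not> f \<subseteq> J" "f \<inter> K = {}" using kj FB by (auto simp: X_def Y_def B_def)
      then show ?thesis by blast
    qed
  qed
  have "3 * card X = card ((\<lambda>(K, J). K \<union> J) ` (Y \<times> X))"
    by (simp add: card_image[OF inj] card_cartesian_product cY)
  also have "\<dots> \<le> card {J. J \<subseteq> A \<and> (\<forall>f\<in>insert e F. \<not> f \<subseteq> J)}"
    by (rule card_mono[OF _ sub]) (use insert.prems(1) in simp)
  finally have "3 * card X \<le> card {J. J \<subseteq> A \<and> (\<forall>f\<in>insert e F. \<not> f \<subseteq> J)}" .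
  then have le: "4 ^ Suc (card F) * (3 * card X)
      \<le> 4 ^ Suc (card F) * card {J. J \<subseteq> A \<and> (\<forall>f\<in>insert e F. \<not> f \<subseteq> J)}"
    by (rule mult_left_mono) simp
  have c: "card (insert e F) = Suc (card F)" using insert.hyps by simp
  have "3 ^ Suc (card F) * (2::nat) ^ card A = 12 * (3 ^ card F * 2 ^ card B)"
    by (simp add: cA)
  also have "\<dots> \<le> 12 * (4 ^ card F * card X)"
    by (rule mult_left_mono[OF IH]) simp
  also have "\<dots> = 4 ^ Suc (card F) * (3 * card X)" by simp
  also note le
  finally show ?case unfolding c .
qed

context affine_plane_of_order
begin

text \<open>A secant through \<open>v\<close> is recorded as its pair of points. For a set
  \<open>U\<close> that is not a cap, these are the potential secants: pairs that may or may not be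
  contained in a given cap of \<open>U\<close>.\<close>

definition secants :: "'a \<Rightarrow> 'a set \<Rightarrow> 'a set set" where
  "secants v I = {e. e \<subseteq> I \<and> card e = 2 \<and> (\<exists>l\<in>L. insert v e \<subseteq> l)}"

definition triples :: "'a set \<Rightarrow> 'a set set" where
  "triples U = {t. t \<subseteq> U \<and> card t = 3 \<and> (\<exists>l\<in>L. t \<subseteq> l)}"

definition caps_in :: "'a set \<Rightarrow> 'a set set" where
  "caps_in U = {I. I \<subseteq> U \<and> cap P L I}"

text \<open>The source of independence: a collinear triple of \<open>U\<close> has at most one point
  among the endpoints of potential secants through \<open>v\<close>. Hence these pairs are disjoint,
  and no triple constrains two of the endpoints jointly.\<close>

definition separating :: "'a \<Rightarrow> 'a set \<Rightarrow> bool" where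
  "separating v U \<longleftrightarrow> v \<in> P - U \<and>
    (\<forall>t\<in>triples U. \<forall>x\<in>t \<inter> \<Union> (secants v U). \<forall>y\<in>t \<inter> \<Union> (secants v U). x = y)"

lemma separatingD:
  assumes "separating v U" "t \<in> triples U" "x \<in> t" "y \<in> t"
    and "x \<in> \<Union> (secants v U)" "y \<in> \<Union> (secants v U)"
  shows "x = y"
proof -
  have "x \<in> t \<inter> \<Union> (secants v U)" "y \<in> t \<inter> \<Union> (secants v U)"
    using assms(3-6) by (simp_all only: Int_iff)
  then show ?thesis using assms(1,2) by (simp only: separating_def)
qed

lemma cap_no_triple: "cap P L S \<Longrightarrow> T \<subseteq> S \<Longrightarrow> card T = 3 \<Longrightarrow> \<not> (\<exists>l\<in>L. T \<subseteq> l)"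
  by (simp add: cap_def)

lemma finite_caps_in: "finite U \<Longrightarrow> finite (caps_in U)"
  by (rule finite_subset[of _ "Pow U"]) (auto simp: caps_in_def)

lemma finite_secants: "finite I \<Longrightarrow> finite (secants v I)"
  by (rule finite_subset[of _ "Pow I"]) (auto simp: secants_def)

lemma finite_triples: "finite U \<Longrightarrow> finite (triples U)"
  by (rule finite_subset[of _ "Pow U"]) (auto simp: triples_def)

lemma caps_in_pos: "finite U \<Longrightarrow> 0 < card (caps_in U)"
  using finite_caps_in[of U] cap_empty by (auto simp: card_gt_0_iff caps_in_def)

lemma cap_insert_iff_secants:
  assumes "v \<in> P" "v \<notin> I" "cap P L I"
  shows "cap P L (insert v I) \<longleftrightarrow> secants v I = {}"
proof -
  have "secants v I = {} \<longleftrightarrow> (\<forall>x\<in>I. \<forall>y\<in>I. x \<noteq> y \<longrightarrow> \<not> collinear v x y)"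
  proof
    assume e: "secants v I = {}"
    show "\<forall>x\<in>I. \<forall>y\<in>I. x \<noteq> y \<longrightarrow> \<not> collinear v x y"
    proof (intro ballI impI notI)
      fix x y assume "x \<in> I" "y \<in> I" "x \<noteq> y" "collinear v x y"
      then have "{x, y} \<in> secants v I" by (auto simp: secants_def collinear_def)
      then show False using e by simp
    qed
  next
    assume r: "\<forall>x\<in>I. \<forall>y\<in>I. x \<noteq> y \<longrightarrow> \<not> collinear v x y"
    show "secants v I = {}"
    proof (rule equals0I)
      fix e assume "e \<in> secants v I"
      then obtain x y l where "x \<in> I" "y \<in> I" "x \<noteq> y" "l \<in> L" "v \<in> l" "x \<in> l" "y \<in> l"
        by (auto simp: secants_def card_2_iff)
      then show False using r unfolding collinear_def by blast
    qed
  qed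
  then show ?thesis using cap_insert[OF assms] by simp
qed

text \<open>Caps that contain \<open>v\<close> correspond, by deleting \<open>v\<close>, to the caps
  of \<open>U\<close> without a secant through \<open>v\<close>.\<close>

lemma card_caps_in_insert:
  assumes "finite U" "v \<in> P - U"
  shows "card (caps_in (insert v U)) = card (caps_in U) + card {I \<in> caps_in U. secants v I = {}}"
proof -
  have "caps_in (insert v U) = caps_in U \<union> insert v ` {I \<in> caps_in U. secants v I = {}}"
  proof (intro equalityI subsetI)
    fix I assume I: "I \<in> caps_in (insert v U)"
    show "I \<in> caps_in U \<union> insert v ` {I \<in> caps_in U. secants v I = {}}"
    proof (cases "v \<in> I")
      case True
      have c: "cap P L (I - {v})" using I cap_mono[of I "I - {v}"] by (auto simp: caps_in_def)
      have i: "insert v (I - {v}) = I" using True by blast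
      have "secants v (I - {v}) = {}"
        using cap_insert_iff_secants[of v "I - {v}"] assms(2) c I
        unfolding i by (simp add: caps_in_def)
      moreover have "I - {v} \<in> caps_in U" using c I by (auto simp: caps_in_def)
      ultimately show ?thesis using i by blast
    next
      case False
      then show ?thesis using I by (auto simp: caps_in_def)
    qed
  next
    fix I assume "I \<in> caps_in U \<union> insert v ` {I \<in> caps_in U. secants v I = {}}"
    then show "I \<in> caps_in (insert v U)"
    proof
      assume "I \<in> caps_in U"
      then show ?thesis by (auto simp: caps_in_def)
    next
      assume "I \<in> insert v ` {I \<in> caps_in U. secants v I = {}}"
      then obtain J where J: "I = insert v J" "J \<in> caps_in U" "secants v J = {}" by blast
      have "v \<notin> J" using J(2) assms(2) by (auto simp: caps_in_def)
      then show ?thesis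
        using cap_insert_iff_secants[of v J] J assms(2) by (auto simp: caps_in_def)
    qed
  qed
  moreover have "caps_in U \<inter> insert v ` {I \<in> caps_in U. secants v I = {}} = {}"
    using assms(2) by (auto simp: caps_in_def)
  moreover have "inj_on (insert v) {I \<in> caps_in U. secants v I = {}}"
    by (rule inj_on_subset[of _ "{I. v \<notin> I}"])
      (use assms(2) in \<open>auto simp: caps_in_def inj_on_def\<close>)
  ultimately show ?thesis
    using finite_caps_in[OF assms(1)] by (simp add: card_Un_disjoint card_image)
qed

text \<open>Two pairs sharing a point \<open>z\<close> lie on the same line, the one through
  \<open>v\<close> and \<open>z\<close>. Their union is then a collinear triple consisting of secant
  endpoints only.\<close>

lemma secants_disjoint:
  assumes sep: "separating v U" and e: "e \<in> secants v U" "f \<in> secants v U" "e \<noteq> f"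
  shows "e \<inter> f = {}"
proof (rule ccontr)
  assume "e \<inter> f \<noteq> {}"
  then obtain z where z: "z \<in> e" "z \<in> f" by blast
  obtain x where x: "e = {z, x}" "z \<noteq> x"
    using e(1) z(1) by (auto simp: secants_def card_2_iff)
  obtain y where y: "f = {z, y}" "z \<noteq> y"
    using e(2) z(2) by (auto simp: secants_def card_2_iff)
  have xy: "x \<noteq> y" using x y e(3) by auto
  obtain l where l: "l \<in> L" "v \<in> l" "z \<in> l" "x \<in> l" using e(1) x by (auto simp: secants_def)
  obtain m where m: "m \<in> L" "v \<in> m" "z \<in> m" "y \<in> m" using e(2) y by (auto simp: secants_def)
  have U: "x \<in> U" "y \<in> U" "z \<in> U" using e x y by (auto simp: secants_def)
  then have "v \<noteq> z" using sep by (auto simp: separating_def)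
  then have "l = m" using line_unique[of l m v z] l m by blast
  then have "{x, y, z} \<in> triples U"
    using l m U x(2) y(2) xy by (auto simp: triples_def)
  moreover have "x \<in> \<Union> (secants v U)" "y \<in> \<Union> (secants v U)" using e x(1) y(1) by blast+
  ultimately have "x = y" by (intro separatingD[OF sep, of "{x, y, z}"]) simp_all
  then show False using xy by simp
qed

text \<open>Off the secants through \<open>v\<close> fix the trace \<open>R\<close> of a cap: \<open>separating\<close> guarantees that
  the rest of the cap is an arbitrary set of points that are individually compatible
  with \<open>R\<close>.\<close>

lemma caps_in_fibre:
  fixes v U R
  defines "X \<equiv> \<Union> (secants v U)"
  defines "A \<equiv> {x\<in>X. cap P L (insert x R)}"
  assumes sep: "separating v U" and R: "R \<subseteq> U - X" "cap P L R"
  shows "{I \<in> caps_in U. I \<inter> (U - X) = R} = (\<union>) R ` Pow A"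
proof (intro equalityI subsetI)
  have XU: "X \<subseteq> U" by (auto simp: X_def secants_def)
  fix I assume I: "I \<in> {I \<in> caps_in U. I \<inter> (U - X) = R}"
  then have "I = R \<union> (I \<inter> X)" using XU by (auto simp: caps_in_def)
  moreover have "I \<inter> X \<in> Pow A"
  proof -
    have "cap P L (insert x R)" if "x \<in> I" for x
      by (rule cap_mono[of I]) (use I that in \<open>auto simp: caps_in_def\<close>)
    then show ?thesis by (auto simp: A_def)
  qed
  ultimately show "I \<in> (\<union>) R ` Pow A" by blast
next
  have XU: "X \<subseteq> U" by (auto simp: X_def secants_def)
  fix I assume "I \<in> (\<union>) R ` Pow A"
  then obtain J where J: "J \<subseteq> A" "I = R \<union> J" by blast
  have IU: "I \<subseteq> U" using J R XU by (auto simp: A_def)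
  have tr: "I \<inter> (U - X) = R" using J R by (auto simp: A_def)
  have JP: "cap P L (insert x R)" if "x \<in> J" for x using J that by (auto simp: A_def)
  \<comment> \<open>A collinear triple not inside \<open>R\<close> has a point \<open>x\<close> in
    \<open>J\<close>, and by separation only one. It is therefore contained in the cap
    \<open>insert x R\<close>.\<close>
  have "\<not> (\<exists>l\<in>L. T \<subseteq> l)" if T: "T \<subseteq> I" "card T = 3" for T
  proof
    assume l: "\<exists>l\<in>L. T \<subseteq> l"
    then have T3: "T \<in> triples U" using T IU by (auto simp: triples_def)
    show False
    proof (cases "T \<subseteq> R")
      case True
      then show False using cap_no_triple[OF R(2) _ T(2)] l by simp
    next
      case False
      then obtain x where x: "x \<in> T" "x \<in> J" using T J by blast
      have "y = x" if "y \<in> T" "y \<in> J" for y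
      proof (rule separatingD[OF sep T3 that(1) x(1)])
        show "y \<in> \<Union> (secants v U)" "x \<in> \<Union> (secants v U)"
          using x(2) that(2) J(1) by (auto simp: A_def X_def)
      qed
      then have "T \<subseteq> insert x R" using T(1) J(2) by auto
      then show False using cap_no_triple[OF JP[OF x(2)] _ T(2)] l by simp
    qed
  qed
  moreover have "I \<subseteq> P"
  proof -
    have "x \<in> P" if "x \<in> J" for x using JP[OF that] by (simp add: cap_def)
    then show ?thesis using R(2) J(2) by (auto simp: cap_def)
  qed
  ultimately have "cap P L I" by (simp add: cap_def)
  then show "I \<in> {I \<in> caps_in U. I \<inter> (U - X) = R}" using IU tr by (simp add: caps_in_def)
qed

text \<open>In a fibre the cap is \<open>R\<close> together with a uniformly random subset of
  \<open>A\<close>, and only the p pairs inside \<open>A\<close> can become secants. So no secant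
  occurs with probability at least (3/4)^p, while 4 times the expected number of secants is p. The
  claim is the tangent at \<open>\<mu>\<close> to the convex function (3/4)^p; one
  \<open>\<mu>\<close> serves for all fibres, so that the inequalities can be added.\<close>

lemma fibre_sum_nonneg:
  fixes v U R and \<mu> :: real
  defines "X \<equiv> \<Union> (secants v U)"
  assumes fin: "finite U" and sep: "separating v U" and R: "R \<subseteq> U - X" "cap P L R"
  shows "0 \<le> (\<Sum>I\<in>{I \<in> caps_in U. I \<inter> (U - X) = R}. (if secants v I = {} then 1 else 0)
    - (3/4) powr \<mu> * (1 + ln (3/4) * (4 * real (card (secants v I)) - \<mu>)))"
proof -
  define A where "A = {x\<in>X. cap P L (insert x R)}"
  define F where "F = {e\<in>secants v U. e \<subseteq> A}"
  define n where "n = (2::real) ^ card A"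
  define p where "p = real (card F)"
  define b where "b = (3/4 :: real) powr \<mu>"
  have XU: "X \<subseteq> U" by (auto simp: X_def secants_def)
  have finA: "finite A" using fin XU by (auto simp: A_def intro: finite_subset)
  have finF: "finite F" using finite_secants[OF fin] by (simp add: F_def)
  have F: "e \<subseteq> A \<and> card e = 2" if "e \<in> F" for e using that by (auto simp: F_def secants_def)
  \<comment> \<open>A secant pair lies inside \<open>X\<close>, which \<open>R\<close> avoids, so
    both its points come from \<open>J\<close>.\<close>
  have sec: "secants v (R \<union> J) = {e\<in>F. e \<subseteq> J}" if J: "J \<subseteq> A" for J
  proof (intro equalityI subsetI)
    fix e assume e: "e \<in> secants v (R \<union> J)"
    have "R \<union> J \<subseteq> U" using J R XU by (auto simp: A_def)
    then have eU: "e \<in> secants v U" using e by (auto simp: secants_def)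
    then have "e \<subseteq> X" by (auto simp: X_def)
    moreover have "e \<subseteq> R \<union> J" using e by (auto simp: secants_def)
    ultimately have "e \<subseteq> J" using R by blast
    then show "e \<in> {e\<in>F. e \<subseteq> J}" using eU J by (auto simp: F_def)
  qed (auto simp: F_def secants_def)
  have inj: "inj_on ((\<union>) R) (Pow A)"
    using R by (auto simp: inj_on_def A_def)
  have free: "(\<Sum>J\<in>Pow A. if {e\<in>F. e \<subseteq> J} = {} then 1 else 0 :: real) \<ge> n * (3/4) ^ card F"
  proof -
    have "Pow A \<inter> {J. {e\<in>F. e \<subseteq> J} = {}} = {J. J \<subseteq> A \<and> (\<forall>e\<in>F. \<not> e \<subseteq> J)}" by auto
    then have "(\<Sum>J\<in>Pow A. if {e\<in>F. e \<subseteq> J} = {} then 1 else 0 :: real)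
        = real (card {J. J \<subseteq> A \<and> (\<forall>e\<in>F. \<not> e \<subseteq> J)})"
      using finA by (simp add: sum.If_cases)
    moreover have "3 ^ card F * 2 ^ card A
        \<le> 4 ^ card F * card {J. J \<subseteq> A \<and> (\<forall>e\<in>F. \<not> e \<subseteq> J)}"
      by (rule card_avoiding_pairs[OF finF finA F])
        (use secants_disjoint[OF sep] in \<open>auto simp: F_def\<close>)
    then have "real (3 ^ card F * 2 ^ card A)
        \<le> real (4 ^ card F * card {J. J \<subseteq> A \<and> (\<forall>e\<in>F. \<not> e \<subseteq> J)})"
      by (simp only: of_nat_le_iff)
    then have "n * (3/4) ^ card F \<le> real (card {J. J \<subseteq> A \<and> (\<forall>e\<in>F. \<not> e \<subseteq> J)})"
      by (simp add: n_def power_divide field_simps)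
    ultimately show ?thesis by simp
  qed
  have pairs: "4 * (\<Sum>J\<in>Pow A. real (card {e\<in>F. e \<subseteq> J})) = p * n"
  proof -
    have "real (4 * (\<Sum>J\<in>Pow A. card {e\<in>F. e \<subseteq> J})) = real (card F * 2 ^ card A)"
      using sum_card_contained_pairs[OF finA finF F] by (simp only: of_nat_eq_iff)
    then show ?thesis by (simp add: p_def n_def)
  qed
  have "(\<Sum>I\<in>{I \<in> caps_in U. I \<inter> (U - X) = R}. (if secants v I = {} then 1 else 0)
      - b * (1 + ln (3/4) * (4 * real (card (secants v I)) - \<mu>)))
    = (\<Sum>J\<in>Pow A. (if secants v (R \<union> J) = {} then 1 else 0)
      - b * (1 + ln (3/4) * (4 * real (card (secants v (R \<union> J))) - \<mu>)))"
    unfolding X_def A_def caps_in_fibre[OF sep R[unfolded X_def]]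
    by (rule sum.reindex_cong[OF inj[unfolded X_def A_def] refl refl])
  also have "\<dots> = (\<Sum>J\<in>Pow A. (if {e\<in>F. e \<subseteq> J} = {} then 1 else 0)
      - b * (1 + ln (3/4) * (4 * real (card {e\<in>F. e \<subseteq> J}) - \<mu>)))"
    by (rule sum.cong[OF refl]) (simp only: Pow_iff sec)
  also have "\<dots> = (\<Sum>J\<in>Pow A. if {e\<in>F. e \<subseteq> J} = {} then 1 else 0 :: real)
      - (b * (1 - ln (3/4) * \<mu>) * n + b * ln (3/4) * (p * n))"
  proof -
    have "(\<Sum>J\<in>Pow A. (if {e\<in>F. e \<subseteq> J} = {} then 1 else 0)
        - b * (1 + ln (3/4) * (4 * real (card {e\<in>F. e \<subseteq> J}) - \<mu>)))
      = (\<Sum>J\<in>Pow A. (if {e\<in>F. e \<subseteq> J} = {} then 1 else 0)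
        - (b * (1 - ln (3/4) * \<mu>) + b * ln (3/4) * (4 * real (card {e\<in>F. e \<subseteq> J}))))"
      by (rule sum.cong[OF refl]) (simp add: algebra_simps)
    also have "\<dots> = (\<Sum>J\<in>Pow A. if {e\<in>F. e \<subseteq> J} = {} then 1 else 0 :: real)
      - (b * (1 - ln (3/4) * \<mu>) * n
        + b * ln (3/4) * (4 * (\<Sum>J\<in>Pow A. real (card {e\<in>F. e \<subseteq> J}))))"
      using finA by (simp add: sum_subtractf sum.distrib card_Pow n_def mult.commute
          flip: sum_distrib_left)
    finally show ?thesis by (simp only: pairs)
  qed
  also have "\<dots> \<ge> 0"
  proof -
    \<comment> \<open>The tangent line is 1 + x <= exp x, applied at x =
      \<open>ln (3/4) * (p - \<mu>)\<close>.\<close>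
    have "(3/4 :: real) ^ card F = exp (p * ln (3/4))"
      by (simp add: p_def powr_def flip: powr_realpow)
    also have "\<dots> = b * exp (ln (3/4) * (p - \<mu>))"
      by (simp add: b_def powr_def algebra_simps flip: exp_add)
    also have "\<dots> \<ge> b * (1 + ln (3/4) * (p - \<mu>))"
      by (intro mult_left_mono exp_ge_add_one_self) (simp add: b_def)
    finally have "n * (b * (1 + ln (3/4) * (p - \<mu>))) \<le> n * (3/4) ^ card F"
      by (intro mult_left_mono) (simp_all add: n_def)
    moreover have "n * (b * (1 + ln (3/4) * (p - \<mu>)))
        = b * (1 - ln (3/4) * \<mu>) * n + b * ln (3/4) * (p * n)"
      by (simp add: algebra_simps)
    ultimately show ?thesis using free by linarith
  qed
  finally show ?thesis by (simp only: b_def)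
qed

definition mean_secants :: "'a \<Rightarrow> 'a set \<Rightarrow> real" where
  "mean_secants v U = (\<Sum>I\<in>caps_in U. real (card (secants v I))) / real (card (caps_in U))"

text \<open>By convexity of \<open>\<lambda>p. (3/4) powr p\<close>, here in the form of a tangent line inequality summed
  over the fibres.\<close>

lemma card_free_caps_ge:
  assumes fin: "finite U" and sep: "separating v U"
  shows "real (card {I \<in> caps_in U. secants v I = {}})
    \<ge> real (card (caps_in U)) * (3/4) powr (4 * mean_secants v U)"
proof -
  define X where "X = \<Union> (secants v U)"
  define N where "N = real (card (caps_in U))"
  define \<mu> where "\<mu> = 4 * mean_secants v U"
  define b where "b = (3/4 :: real) powr \<mu>"
  define g where "g I = (if secants v I = {} then 1 else 0)
    - b * (1 + ln (3/4) * (4 * real (card (secants v I)) - \<mu>))" for I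
  have N: "N > 0" using caps_in_pos[OF fin] by (simp add: N_def)
  \<comment> \<open>Because \<open>\<mu>\<close> is 4 times the mean over all caps, the linear terms
    of the tangent cancel in the total sum.\<close>
  have S: "4 * (\<Sum>I\<in>caps_in U. real (card (secants v I))) = \<mu> * N"
    using N by (simp add: \<mu>_def mean_secants_def N_def)
  have "(\<Sum>I\<in>caps_in U. g I)
      = (\<Sum>R\<in>(\<lambda>I. I \<inter> (U - X)) ` caps_in U. \<Sum>I\<in>{I \<in> caps_in U. I \<inter> (U - X) = R}. g I)"
    by (rule sum.image_gen[OF finite_caps_in[OF fin]])
  also have "\<dots> \<ge> 0"
  proof (rule sum_nonneg)
    fix R assume "R \<in> (\<lambda>I. I \<inter> (U - X)) ` caps_in U"
    then obtain I where I: "I \<in> caps_in U" "R = I \<inter> (U - X)" by blast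
    have "R \<subseteq> U - X" "cap P L R"
      using I cap_mono[of I R] by (auto simp: caps_in_def)
    from fibre_sum_nonneg[OF fin sep this[unfolded X_def]]
    show "0 \<le> (\<Sum>I\<in>{I \<in> caps_in U. I \<inter> (U - X) = R}. g I)"
      unfolding g_def b_def X_def .
  qed
  finally have "0 \<le> (\<Sum>I\<in>caps_in U. g I)" .
  also have "\<dots> = (\<Sum>I\<in>caps_in U. (if secants v I = {} then 1 else 0)
      - (b * (1 - ln (3/4) * \<mu>) + b * ln (3/4) * (4 * real (card (secants v I)))))"
    by (rule sum.cong[OF refl]) (simp add: g_def algebra_simps)
  also have "\<dots> = (\<Sum>I\<in>caps_in U. if secants v I = {} then 1 else 0 :: real)
      - (b * (1 - ln (3/4) * \<mu>) * N
        + b * ln (3/4) * (4 * (\<Sum>I\<in>caps_in U. real (card (secants v I)))))"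
    by (simp add: sum_subtractf sum.distrib N_def mult.commute flip: sum_distrib_left)
  also have "\<dots> = real (card {I \<in> caps_in U. secants v I = {}}) - b * N"
    unfolding S using finite_caps_in[OF fin]
    by (simp add: sum.If_cases Int_def algebra_simps)
  finally show ?thesis by (simp add: b_def N_def \<mu>_def mult.commute)
qed

lemma card_caps_in_insert_ge:
  assumes "finite U" "separating v U"
  shows "real (card (caps_in (insert v U)))
    \<ge> real (card (caps_in U)) * (1 + (3/4) powr (4 * mean_secants v U))"
proof -
  have "v \<in> P - U" using assms(2) by (simp only: separating_def)
  then show ?thesis
    using card_free_caps_ge[OF assms] card_caps_in_insert[OF assms(1), of v]
    by (simp add: distrib_left)
qed

end

subsection \<open>Averages over the points of the plane\<close>

text \<open>Markov's inequality.\<close>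

lemma card_exceeding_le:
  fixes f :: "'a \<Rightarrow> real"
  assumes "finite A" "\<And>x. x \<in> A \<Longrightarrow> 0 \<le> f x" "c > 0"
  shows "real (card {x\<in>A. f x > c}) \<le> (\<Sum>x\<in>A. f x) / c"
proof -
  have "real (card {x\<in>A. f x > c}) * c = (\<Sum>x\<in>{x\<in>A. f x > c}. c)" by simp
  also have "\<dots> \<le> (\<Sum>x\<in>{x\<in>A. f x > c}. f x)" by (rule sum_mono) simp
  also have "\<dots> \<le> (\<Sum>x\<in>A. f x)" by (rule sum_mono2) (use assms in auto)
  finally show ?thesis using assms(3) by (simp add: pos_le_divide_eq)
qed

text \<open>Such a set arises from \<open>s\<close> successive choices out of \<open>U\<close> and
  one extra value \<open>None\<close>, meaning no new point.\<close>

lemma card_small_subsets_le: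
  assumes "finite U"
  shows "card {I. I \<subseteq> U \<and> card I \<le> s} \<le> (card U + 1) ^ s"
proof (induction s)
  case 0
  have "{I. I \<subseteq> U \<and> card I \<le> 0} \<subseteq> {{}}"
  proof
    fix I assume "I \<in> {I. I \<subseteq> U \<and> card I \<le> 0}"
    then have "finite I" "card I = 0" by (auto intro: finite_subset[OF _ assms])
    then show "I \<in> {{}}" by simp
  qed
  then have "card {I. I \<subseteq> U \<and> card I \<le> 0} \<le> card {{} :: 'a set}" by (rule card_mono[rotated]) simp
  then show ?case by simp
next
  case (Suc s)
  let ?S = "\<lambda>s. {I. I \<subseteq> U \<and> card I \<le> s}"
  let ?f = "\<lambda>(x, J). case x of None \<Rightarrow> J | Some u \<Rightarrow> insert u J"
  let ?O = "insert None (Some ` U)"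
  have finS: "finite (?S s)"
    by (rule finite_subset[of _ "Pow U"]) (use assms in auto)
  have "?S (Suc s) \<subseteq> ?f ` (?O \<times> ?S s)"
  proof
    fix I assume I: "I \<in> ?S (Suc s)"
    show "I \<in> ?f ` (?O \<times> ?S s)"
    proof (cases "I = {}")
      case True
      then have "I = ?f (None, {})" "(None, {}) \<in> ?O \<times> ?S s" by auto
      then show ?thesis by (rule image_eqI)
    next
      case False
      then obtain u where u: "u \<in> I" by blast
      have finI: "finite I" using I assms finite_subset by auto
      have "I = ?f (Some u, I - {u})" using u by auto
      moreover have "(Some u, I - {u}) \<in> ?O \<times> ?S s"
        using I u finI by (auto simp: card_Diff_singleton)
      ultimately show ?thesis by (rule image_eqI)
    qed
  qed
  then have "card (?S (Suc s)) \<le> card (?f ` (?O \<times> ?S s))"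
    using finS assms by (intro card_mono) auto
  also have "\<dots> \<le> card (?O \<times> ?S s)"
    using finS assms by (intro card_image_le) auto
  also have "\<dots> = (card U + 1) * card (?S s)"
    using assms by (simp add: card_cartesian_product card_image card_insert_if)
  also have "\<dots> \<le> (card U + 1) * (card U + 1) ^ s"
    by (rule mult_left_mono[OF Suc.IH]) simp
  finally show ?case by simp
qed

text \<open>A random sequence of length \<open>m\<close> contains all of \<open>I\<close> with
  probability at most (m/n)^t, where n = \<open>card A\<close> and t = \<open>card I\<close>. The
  induction distinguishes whether the first entry belongs to \<open>I\<close>; if so, only the rest
  of \<open>I\<close> must still occur.\<close>

lemma card_lists_containing_le:
  assumes "finite A" "finite I" "I \<subseteq> A"
  shows "card {vs. set vs \<subseteq> A \<and> length vs = m \<and> I \<subseteq> set vs} * card A ^ card I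
    \<le> m ^ card I * card A ^ m"
  using assms(2,3)
proof (induction m arbitrary: I)
  case 0
  show ?case
  proof (cases "I = {}")
    case True
    have "{vs. set vs \<subseteq> A \<and> length vs = 0 \<and> {} \<subseteq> set vs} = {[]}" by auto
    then show ?thesis using True by simp
  next
    case False
    then have e: "{vs. set vs \<subseteq> A \<and> length vs = 0 \<and> I \<subseteq> set vs} = {}" by auto
    show ?thesis unfolding e by simp
  qed
next
  case (Suc m)
  let ?S = "\<lambda>I m. {vs. set vs \<subseteq> A \<and> length vs = m \<and> I \<subseteq> set vs}"
  let ?n = "card A" and ?t = "card I"
  have fin: "finite (?S J k)" for J k
    by (rule finite_subset[OF _ finite_lists_length_eq[OF assms(1), of k]]) auto
  have "?S I (Suc m) \<subseteq> (\<Union>v\<in>I. (#) v ` ?S (I - {v}) m) \<union> (\<Union>v\<in>A. (#) v ` ?S I m)"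
  proof
    fix ws assume ws: "ws \<in> ?S I (Suc m)"
    then obtain v vs where v: "ws = v # vs" by (cases ws) auto
    show "ws \<in> (\<Union>v\<in>I. (#) v ` ?S (I - {v}) m) \<union> (\<Union>v\<in>A. (#) v ` ?S I m)"
    proof (cases "v \<in> I")
      case True
      then have "vs \<in> ?S (I - {v}) m" using ws v by auto
      then show ?thesis using v True by auto
    next
      case False
      then have "vs \<in> ?S I m" "v \<in> A" using ws v by auto
      then show ?thesis using v by auto
    qed
  qed
  then have "card (?S I (Suc m))
      \<le> card ((\<Union>v\<in>I. (#) v ` ?S (I - {v}) m) \<union> (\<Union>v\<in>A. (#) v ` ?S I m))"
    using Suc.prems assms(1) fin by (intro card_mono) auto
  also have "\<dots> \<le> card (\<Union>v\<in>I. (#) v ` ?S (I - {v}) m) + card (\<Union>v\<in>A. (#) v ` ?S I m)"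
    by (rule card_Un_le)
  also have "\<dots> \<le> (\<Sum>v\<in>I. card (?S (I - {v}) m)) + (\<Sum>v\<in>A. card (?S I m))"
  proof (rule add_mono)
    have "card (\<Union>v\<in>I. (#) v ` ?S (I - {v}) m) \<le> (\<Sum>v\<in>I. card ((#) v ` ?S (I - {v}) m))"
      by (rule card_UN_le[OF Suc.prems(1)])
    also have "\<dots> \<le> (\<Sum>v\<in>I. card (?S (I - {v}) m))"
      by (rule sum_mono) (rule card_image_le[OF fin])
    finally show "card (\<Union>v\<in>I. (#) v ` ?S (I - {v}) m) \<le> (\<Sum>v\<in>I. card (?S (I - {v}) m))" .
    have "card (\<Union>v\<in>A. (#) v ` ?S I m) \<le> (\<Sum>v\<in>A. card ((#) v ` ?S I m))"
      by (rule card_UN_le[OF assms(1)])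
    also have "\<dots> \<le> (\<Sum>v\<in>A. card (?S I m))"
      by (rule sum_mono) (rule card_image_le[OF fin])
    finally show "card (\<Union>v\<in>A. (#) v ` ?S I m) \<le> (\<Sum>v\<in>A. card (?S I m))" .
  qed
  finally have "card (?S I (Suc m)) * ?n ^ ?t
      \<le> ((\<Sum>v\<in>I. card (?S (I - {v}) m)) + ?n * card (?S I m)) * ?n ^ ?t"
    by (intro mult_right_mono) simp_all
  also have "\<dots> = (\<Sum>v\<in>I. card (?S (I - {v}) m) * ?n ^ ?t) + ?n * (card (?S I m) * ?n ^ ?t)"
    by (simp add: distrib_right sum_distrib_right mult.assoc)
  also have "\<dots> \<le> (\<Sum>v\<in>I. ?n * (m ^ (?t - 1) * ?n ^ m)) + ?n * (m ^ ?t * ?n ^ m)"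
  proof (intro add_mono sum_mono mult_left_mono Suc.IH Suc.prems)
    fix v assume v: "v \<in> I"
    have t: "?t = Suc (?t - 1)" using v Suc.prems(1) card_gt_0_iff[of I] by auto
    have "card (I - {v}) = ?t - 1" using v Suc.prems(1) by (simp add: card_Diff_singleton)
    then have "card (?S (I - {v}) m) * ?n ^ (?t - 1) \<le> m ^ (?t - 1) * ?n ^ m"
      using Suc.IH[of "I - {v}"] Suc.prems by auto
    then have "?n * (card (?S (I - {v}) m) * ?n ^ (?t - 1)) \<le> ?n * (m ^ (?t - 1) * ?n ^ m)"
      by (rule mult_left_mono) simp
    moreover have "?n ^ ?t = ?n * ?n ^ (?t - 1)" by (subst t) simp
    ultimately show "card (?S (I - {v}) m) * ?n ^ ?t \<le> ?n * (m ^ (?t - 1) * ?n ^ m)"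
      by (simp only: mult.left_commute)
  qed simp_all
  also have "\<dots> = (?t * m ^ (?t - 1) + m ^ ?t) * ?n ^ Suc m"
    by (simp add: algebra_simps)
  also have "\<dots> \<le> Suc m ^ ?t * ?n ^ Suc m"
  proof (rule mult_right_mono)
    \<comment> \<open>These are the first two terms of the binomial expansion; for
      \<open>k = 0\<close> the factor \<open>k\<close> removes the truncated exponent.\<close>
    have "k * m ^ (k - 1) + m ^ k \<le> Suc m ^ k" for k
    proof (induction k)
      case (Suc k)
      have "k * m ^ k = m * (k * m ^ (k - 1))" by (cases k) (simp_all add: algebra_simps)
      then have "Suc k * m ^ k + m ^ Suc k = m * (k * m ^ (k - 1) + m ^ k) + m ^ k"
        by (simp add: algebra_simps)
      also have "\<dots> \<le> m * Suc m ^ k + Suc m ^ k"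
        by (intro add_mono mult_left_mono Suc.IH power_mono) simp_all
      finally show ?case by simp
    qed simp
    then show "?t * m ^ (?t - 1) + m ^ ?t \<le> Suc m ^ ?t" .
  qed simp
  finally show ?case .
qed

context affine_plane_of_order
begin

lemma card_on_secant_le:
  assumes "card e = 2"
  shows "card {v\<in>P. \<exists>l\<in>L. insert v e \<subseteq> l} \<le> q"
proof (cases "\<exists>l\<in>L. e \<subseteq> l")
  case True
  then obtain l where l: "l \<in> L" "e \<subseteq> l" by blast
  obtain x y where xy: "e = {x, y}" "x \<noteq> y" using assms by (auto simp: card_2_iff)
  have "{v\<in>P. \<exists>l\<in>L. insert v e \<subseteq> l} \<subseteq> l"
  proof
    fix v assume "v \<in> {v\<in>P. \<exists>l\<in>L. insert v e \<subseteq> l}"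
    then obtain m where m: "m \<in> L" "v \<in> m" "x \<in> m" "y \<in> m" using xy(1) by auto
    have "m = l" by (rule line_unique[of m l x y]) (use m l xy in auto)
    then show "v \<in> l" using m by simp
  qed
  from card_mono[OF finite_line[OF l(1)] this] show ?thesis using card_line[OF l(1)] by simp
next
  case False
  then have e: "{v\<in>P. \<exists>l\<in>L. insert v e \<subseteq> l} = {}" by auto
  show ?thesis unfolding e by simp
qed

text \<open>Double counting: each of the at most s^2/2 pairs spans a line, and \<open>v\<close> is
  one of its \<open>q\<close> points.\<close>

lemma sum_secants_le:
  assumes "finite I" "card I \<le> s"
  shows "(\<Sum>v\<in>P. real (card (secants v I))) \<le> real q * (real s)\<^sup>2 / 2"
proof -
  define E where "E = {e. e \<subseteq> I \<and> card e = 2}"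
  have finE: "finite E" by (rule finite_subset[of _ "Pow I"]) (use assms(1) in \<open>auto simp: E_def\<close>)
  have "(\<Sum>v\<in>P. card (secants v I)) = (\<Sum>v\<in>P. \<Sum>e\<in>E. if \<exists>l\<in>L. insert v e \<subseteq> l then 1 else 0)"
  proof (rule sum.cong[OF refl])
    fix v
    have "secants v I = E \<inter> {e. \<exists>l\<in>L. insert v e \<subseteq> l}" by (auto simp: secants_def E_def)
    then show "card (secants v I) = (\<Sum>e\<in>E. if \<exists>l\<in>L. insert v e \<subseteq> l then 1 else 0)"
      using finE by (simp add: sum.If_cases)
  qed
  also have "\<dots> = (\<Sum>e\<in>E. \<Sum>v\<in>P. if \<exists>l\<in>L. insert v e \<subseteq> l then 1 else 0)"
    by (rule sum.swap)
  also have "\<dots> = (\<Sum>e\<in>E. card {v\<in>P. \<exists>l\<in>L. insert v e \<subseteq> l})"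
    using finite_points by (simp add: sum.If_cases Int_def)
  also have "\<dots> \<le> (\<Sum>e\<in>E. q)"
    by (rule sum_mono) (simp only: E_def mem_Collect_eq card_on_secant_le)
  also have "\<dots> = (card I choose 2) * q"
    using n_subsets[OF assms(1), of 2] by (simp add: E_def)
  finally have "(\<Sum>v\<in>P. card (secants v I)) \<le> (card I choose 2) * q" .
  then have "real (\<Sum>v\<in>P. card (secants v I)) \<le> real ((card I choose 2) * q)"
    by (simp only: of_nat_le_iff)
  also have "\<dots> \<le> (real s)\<^sup>2 / 2 * real q"
  proof -
    have "2 * (card I choose 2) \<le> card I * card I"
    proof -
      have "2 * (card I choose 2) \<le> card I * (card I - 1)"
        unfolding choose_two by (rule times_div_less_eq_dividend)
      also have "\<dots> \<le> card I * card I" by (intro mult_left_mono) auto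
      finally show ?thesis .
    qed
    also have "\<dots> \<le> s * s" using assms(2) by (intro mult_mono) auto
    finally have "real (2 * (card I choose 2)) \<le> real (s * s)" by (simp only: of_nat_le_iff)
    then have "real (card I choose 2) \<le> (real s)\<^sup>2 / 2" by (simp add: power2_eq_square)
    from mult_right_mono[OF this, of "real q"] show ?thesis by simp
  qed
  finally show ?thesis by (simp add: mult.commute)
qed

lemma sum_mean_secants_le:
  assumes "finite U" "\<And>I. I \<in> caps_in U \<Longrightarrow> card I \<le> s"
  shows "(\<Sum>v\<in>P. mean_secants v U) \<le> real q * (real s)\<^sup>2 / 2"
proof -
  define N where "N = real (card (caps_in U))"
  have N: "N > 0" using caps_in_pos[OF assms(1)] by (simp add: N_def)
  have "(\<Sum>v\<in>P. mean_secants v U) = (\<Sum>v\<in>P. \<Sum>I\<in>caps_in U. real (card (secants v I))) / N"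
    by (simp add: mean_secants_def N_def sum_divide_distrib)
  also have "\<dots> = (\<Sum>I\<in>caps_in U. \<Sum>v\<in>P. real (card (secants v I))) / N"
    by (simp only: sum.swap[of _ P])
  also have "\<dots> \<le> (\<Sum>I\<in>caps_in U. real q * (real s)\<^sup>2 / 2) / N"
  proof (intro divide_right_mono sum_mono)
    fix I assume I: "I \<in> caps_in U"
    then have "finite I" using assms(1) finite_subset by (auto simp: caps_in_def)
    from sum_secants_le[OF this assms(2)[OF I]]
    show "(\<Sum>v\<in>P. real (card (secants v I))) \<le> real q * (real s)\<^sup>2 / 2" .
  qed (use N in simp)
  also have "\<dots> = real q * (real s)\<^sup>2 / 2" using N by (simp add: N_def)
  finally show ?thesis .
qed

lemma card_triples_insert_le:
  assumes "finite U" "v \<in> P - U"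
  shows "card (triples (insert v U)) \<le> card (triples U) + card (secants v U)"
proof -
  have "triples (insert v U) \<subseteq> triples U \<union> insert v ` secants v U"
  proof
    fix t assume t: "t \<in> triples (insert v U)"
    show "t \<in> triples U \<union> insert v ` secants v U"
    proof (cases "v \<in> t")
      case True
      have "finite t" using t assms(1) finite_subset by (auto simp: triples_def)
      then have "t - {v} \<in> secants v U" "t = insert v (t - {v})"
        using t True by (auto simp: triples_def secants_def card_Diff_singleton)
      then show ?thesis by blast
    next
      case False
      then show ?thesis using t by (auto simp: triples_def)
    qed
  qed
  then have "card (triples (insert v U)) \<le> card (triples U \<union> insert v ` secants v U)"
    using finite_triples finite_secants assms(1) by (intro card_mono) auto
  also have "\<dots> \<le> card (triples U) + card (insert v ` secants v U)" by (rule card_Un_le)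
  also have "card (insert v ` secants v U) \<le> card (secants v U)"
    by (rule card_image_le[OF finite_secants[OF assms(1)]])
  finally show ?thesis by simp
qed

text \<open>The intersection point of the lines xx' and yy', as a set so that coinciding or parallel
  lines yield the empty set.\<close>

definition crossing :: "'a \<Rightarrow> 'a \<Rightarrow> 'a \<Rightarrow> 'a \<Rightarrow> 'a set" where
  "crossing x x' y y' = {v\<in>P. x \<noteq> x' \<and> y \<noteq> y' \<and> (\<exists>l\<in>L. \<exists>m\<in>L. l \<noteq> m \<and>
    v \<in> l \<and> x \<in> l \<and> x' \<in> l \<and> v \<in> m \<and> y \<in> m \<and> y' \<in> m)}"

lemma card_crossing_le: "card (crossing x x' y y') \<le> 1"
proof -
  have "v = w" if v: "v \<in> crossing x x' y y'" and w: "w \<in> crossing x x' y y'" for v w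
  proof (rule ccontr)
    assume "v \<noteq> w"
    from v obtain l m where lm: "l \<in> L" "m \<in> L" "l \<noteq> m" "v \<in> l" "x \<in> l" "x' \<in> l"
      "v \<in> m" "y \<in> m" "y' \<in> m" and ne: "x \<noteq> x'" "y \<noteq> y'"
      unfolding crossing_def by blast
    from w obtain l' m' where lm': "l' \<in> L" "m' \<in> L" "w \<in> l'" "x \<in> l'" "x' \<in> l'"
      "w \<in> m'" "y \<in> m'" "y' \<in> m'"
      unfolding crossing_def by blast
    have "l = l'" by (rule line_unique[OF lm(1) lm'(1) lm(5,6) lm'(4,5) ne(1)])
    moreover have "m = m'" by (rule line_unique[OF lm(2) lm'(2) lm(8,9) lm'(7,8) ne(2)])
    ultimately have "l = m"
      using line_unique[OF lm(1,2) lm(4) _ lm(7) _ \<open>v \<noteq> w\<close>] lm' by simp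
    then show False using lm(3) by simp
  qed
  moreover have "finite (crossing x x' y y')" using finite_points by (simp add: crossing_def)
  ultimately show ?thesis by (simp add: card_le_Suc0_iff_eq)
qed

text \<open>Suppose \<open>x\<close> and \<open>y\<close> in a triple \<open>t\<close> are both
  endpoints of secants through \<open>v\<close>. If the two secant lines coincide, they are the line
  of \<open>t\<close>, and \<open>v\<close> is one of its \<open>q\<close> points. Otherwise
  \<open>v\<close> is the crossing of xx' and yy' with x', y' in \<open>U\<close>; there are 9
  choices for (x, y) and |U|^2 for (x', y').\<close>

lemma card_not_separating_le:
  assumes U: "U \<subseteq> P"
  shows "card {v\<in>P - U. \<not> separating v U} \<le> card (triples U) * (q + 9 * (card U)\<^sup>2)"
proof -
  have finU: "finite U" by (rule finite_subset[OF U finite_points])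
  define B where "B t = {v\<in>P. \<exists>l\<in>L. insert v t \<subseteq> l}
    \<union> (\<Union>(x, y)\<in>t \<times> t. \<Union>(x', y')\<in>U \<times> U. crossing x x' y y')" for t
  have t: "finite t" "card t = 3" if "t \<in> triples U" for t
    using that finU finite_subset by (auto simp: triples_def)
  have finB: "finite (B t)" for t
    by (rule finite_subset[OF _ finite_points]) (auto simp: B_def crossing_def)
  have cB: "card (B t) \<le> q + 9 * (card U)\<^sup>2" if tt: "t \<in> triples U" for t
  proof -
    have c: "card (\<Union>(x', y')\<in>U \<times> U. crossing x x' y y') \<le> (card U)\<^sup>2" for x y
    proof -
      have "card (\<Union>z\<in>U \<times> U. case z of (x', y') \<Rightarrow> crossing x x' y y')
          \<le> (\<Sum>z\<in>U \<times> U. card (case z of (x', y') \<Rightarrow> crossing x x' y y'))"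
        by (rule card_UN_le) (use finU in simp)
      also have "\<dots> \<le> (\<Sum>z\<in>U \<times> U. 1)"
        by (rule sum_mono) (simp only: case_prod_beta card_crossing_le)
      finally show ?thesis by (simp add: card_cartesian_product power2_eq_square)
    qed
    have "card (\<Union>z\<in>t \<times> t. case z of (x, y) \<Rightarrow> \<Union>(x', y')\<in>U \<times> U. crossing x x' y y')
        \<le> (\<Sum>z\<in>t \<times> t. card (case z of (x, y) \<Rightarrow> \<Union>(x', y')\<in>U \<times> U. crossing x x' y y'))"
      by (rule card_UN_le) (use t[OF tt] in simp)
    also have "\<dots> \<le> (\<Sum>z\<in>t \<times> t. (card U)\<^sup>2)"
    proof (rule sum_mono)
      fix z
      show "card (case z of (x, y) \<Rightarrow> \<Union>(x', y')\<in>U \<times> U. crossing x x' y y') \<le> (card U)\<^sup>2"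
        using c[of "fst z" "snd z"] by (simp only: case_prod_beta)
    qed
    also have "\<dots> = 9 * (card U)\<^sup>2" by (simp add: card_cartesian_product t[OF tt])
    finally have 2: "card (\<Union>z\<in>t \<times> t. case z of (x, y) \<Rightarrow>
      \<Union>(x', y')\<in>U \<times> U. crossing x x' y y') \<le> 9 * (card U)\<^sup>2" .
    obtain x y z where xyz: "t = {x, y, z}" "x \<noteq> y" using t(2)[OF tt] by (auto simp: card_3_iff)
    have "card {v\<in>P. \<exists>l\<in>L. insert v t \<subseteq> l} \<le> card {v\<in>P. \<exists>l\<in>L. insert v {x, y} \<subseteq> l}"
      by (rule card_mono) (use finite_points xyz in auto)
    also have "\<dots> \<le> q" by (rule card_on_secant_le) (use xyz in simp)
    finally have 1: "card {v\<in>P. \<exists>l\<in>L. insert v t \<subseteq> l} \<le> q" .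
    show ?thesis unfolding B_def using card_Un_le 1 2 by (rule order_trans[OF _ add_mono])
  qed
  have "{v\<in>P - U. \<not> separating v U} \<subseteq> (\<Union>t\<in>triples U. B t)"
  proof
    fix v assume v: "v \<in> {v\<in>P - U. \<not> separating v U}"
    then obtain t x y where txy: "t \<in> triples U" "x \<in> t" "y \<in> t" "x \<noteq> y"
      and X: "x \<in> \<Union> (secants v U)" "y \<in> \<Union> (secants v U)"
      unfolding separating_def by blast
    have vP: "v \<in> P" using v by simp
    obtain e where e: "e \<in> secants v U" "x \<in> e" using X(1) by blast
    obtain f where f: "f \<in> secants v U" "y \<in> f" using X(2) by blast
    obtain x' where x': "x' \<in> U" "x \<noteq> x'" "e = {x, x'}"
      using e by (auto simp: secants_def card_2_iff)
    obtain y' where y': "y' \<in> U" "y \<noteq> y'" "f = {y, y'}"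
      using f by (auto simp: secants_def card_2_iff)
    obtain l where l: "l \<in> L" "v \<in> l" "x \<in> l" "x' \<in> l" using e(1) x'(3) by (auto simp: secants_def)
    obtain m where m: "m \<in> L" "v \<in> m" "y \<in> m" "y' \<in> m" using f(1) y'(3) by (auto simp: secants_def)
    have "v \<in> B t"
    proof (cases "l = m")
      case True
      obtain k where k: "k \<in> L" "t \<subseteq> k" using txy(1) by (auto simp: triples_def)
      have "k = l"
        by (rule line_unique[of k l x y]) (use k l m True txy in auto)
      then have "v \<in> {v\<in>P. \<exists>l\<in>L. insert v t \<subseteq> l}" using k l vP by auto
      then show ?thesis by (simp only: B_def Un_iff simp_thms)
    next
      case False
      have "\<exists>l\<in>L. \<exists>m\<in>L. l \<noteq> m \<and> v \<in> l \<and> x \<in> l \<and> x' \<in> l \<and> v \<in> m \<and> y \<in> m \<and> y' \<in> m"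
        by (rule bexI[OF _ l(1)], rule bexI[OF _ m(1)]) (use False l m in simp)
      then have "v \<in> crossing x x' y y'"
        using vP x'(2) y'(2) unfolding crossing_def by simp
      then have "v \<in> (\<Union>(x', y')\<in>U \<times> U. crossing x x' y y')"
        by (intro UN_I[of "(x', y')"]) (simp_all add: x'(1) y'(1))
      then have "v \<in> (\<Union>(x, y)\<in>t \<times> t. \<Union>(x', y')\<in>U \<times> U. crossing x x' y y')"
        by (intro UN_I[of "(x, y)" "t \<times> t"]) (simp_all add: txy(2,3))
      then show ?thesis by (simp only: B_def Un_iff simp_thms)
    qed
    then show "v \<in> (\<Union>t\<in>triples U. B t)" using txy(1) by blast
  qed
  then have "card {v\<in>P - U. \<not> separating v U} \<le> card (\<Union>t\<in>triples U. B t)"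
    using finB finite_triples[OF finU] by (intro card_mono) auto
  also have "\<dots> \<le> (\<Sum>t\<in>triples U. card (B t))" by (rule card_UN_le[OF finite_triples[OF finU]])
  also have "\<dots> \<le> (\<Sum>t\<in>triples U. q + 9 * (card U)\<^sup>2)" by (rule sum_mono[OF cB])
  finally show ?thesis by simp
qed

end

subsection \<open>Growth along sequences of points\<close>

context affine_plane_of_order
begin

text \<open>The bound on secants limits the collinear triples created by adding \<open>v\<close>, so
  that non-separating points stay rare later on.\<close>

definition admissible :: "real \<Rightarrow> 'a \<Rightarrow> 'a set \<Rightarrow> bool" where
  "admissible K v U \<longleftrightarrow> separating v U \<and> real (card (secants v U)) \<le> K"

text \<open>The list is processed from its end, so \<open>v # vs\<close> means that \<open>v\<close>
  is drawn after \<open>vs\<close>. Inadmissible points are skipped.\<close>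

primrec run :: "real \<Rightarrow> 'a list \<Rightarrow> 'a set" where
  "run K [] = {}"
| "run K (v # vs) = (if admissible K v (run K vs) then insert v (run K vs) else run K vs)"

lemma run_subset: "run K vs \<subseteq> set vs"
  by (induction vs) auto

lemma finite_run: "finite (run K vs)"
  by (rule finite_subset[OF run_subset finite_set])

lemma card_run_le: "card (run K vs) \<le> length vs"
  by (rule order_trans[OF card_mono[OF finite_set run_subset] card_length])

lemma card_triples_run_le: "K \<ge> 0 \<Longrightarrow> real (card (triples (run K vs))) \<le> K * real (length vs)"
proof (induction vs)
  case Nil
  have "triples {} = {}" by (auto simp: triples_def)
  then show ?case by simp
next
  case (Cons v vs)
  then have IH: "real (card (triples (run K vs))) \<le> K * real (length vs)" by simp
  show ?case
  proof (cases "admissible K v (run K vs)")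
    case True
    then have "v \<in> P - run K vs" "real (card (secants v (run K vs))) \<le> K"
      by (simp_all only: admissible_def separating_def)
    then show ?thesis
      using True IH card_triples_insert_le[OF finite_run, of v K vs] by (simp add: distrib_left)
  next
    case False
    then show ?thesis using IH Cons.prems by (simp add: distrib_left)
  qed
qed

lemma caps_in_mono: "U \<subseteq> V \<Longrightarrow> caps_in U \<subseteq> caps_in V"
  by (auto simp: caps_in_def)

context
  fixes m s :: nat and K \<eta> :: real
  assumes pos: "0 < q" "0 < m" "0 < s"
    and K: "K = 4 * (real m)\<^sup>2 / real q"
    and \<eta>: "\<eta> = (3/4) powr (8 * (real s)\<^sup>2 / real q)"
    and m_small: "8 * real m \<le> (real q)\<^sup>2"
    and bad_small: "8 * (K * real m * (real q + 9 * (real m)\<^sup>2)) \<le> (real q)\<^sup>2"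
begin

text \<open>A union bound: the points of \<open>U\<close>, the non-separating ones and those with
  more than \<open>K\<close> secants take at most 1/8 of the plane each, those with too large a mean
  at most 1/4. For the last two, Markov is applied with thresholds 8 and 4 times the bounds m^2/(2q)
  and s^2/(2q) on the averages.\<close>

lemma card_good_points_ge:
  assumes U: "U \<subseteq> P" "card U \<le> m" and tr: "real (card (triples U)) \<le> K * real m"
    and caps: "\<And>I. I \<in> caps_in U \<Longrightarrow> card I \<le> s"
  shows "real (card {v\<in>P. admissible K v U \<and> mean_secants v U \<le> 2 * (real s)\<^sup>2 / real q})
    \<ge> (real q)\<^sup>2 / 4"
proof -
  let ?G = "{v\<in>P. admissible K v U \<and> mean_secants v U \<le> 2 * (real s)\<^sup>2 / real q}"
  let ?B1 = "{v\<in>P - U. \<not> separating v U}"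
  let ?B2 = "{v\<in>P. real (card (secants v U)) > K}"
  let ?B3 = "{v\<in>P. mean_secants v U > 2 * (real s)\<^sup>2 / real q}"
  have finU: "finite U" by (rule finite_subset[OF U(1) finite_points])
  have q: "real q > 0" "real m > 0" "real s > 0" using pos by simp_all
  have "P \<subseteq> ?G \<union> (U \<union> (?B1 \<union> (?B2 \<union> ?B3)))"
    by (auto simp: admissible_def not_le)
  then have "card P \<le> card (?G \<union> (U \<union> (?B1 \<union> (?B2 \<union> ?B3))))"
    using finite_points finU by (intro card_mono) auto
  also have "\<dots> \<le> card ?G + (card U + (card ?B1 + (card ?B2 + card ?B3)))"
    by (intro order_trans[OF card_Un_le] add_left_mono order_refl)
  finally have "real (card P) \<le> real (card ?G + (card U + (card ?B1 + (card ?B2 + card ?B3))))"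
    by (simp only: of_nat_le_iff)
  then have tot: "(real q)\<^sup>2 \<le> real (card ?G) + real (card U) + real (card ?B1) + real (card ?B2)
      + real (card ?B3)" by (simp add: card_points)
  have b0: "real (card U) \<le> (real q)\<^sup>2 / 8" using U(2) m_small by simp
  have b1: "real (card ?B1) \<le> (real q)\<^sup>2 / 8"
  proof -
    have "real (card ?B1) \<le> real (card (triples U) * (q + 9 * (card U)\<^sup>2))"
      using card_not_separating_le[OF U(1)] by (simp only: of_nat_le_iff)
    also have "\<dots> = real (card (triples U)) * (real q + 9 * (real (card U))\<^sup>2)" by simp
    also have "\<dots> \<le> (K * real m) * (real q + 9 * (real m)\<^sup>2)"
      using tr U(2) by (intro mult_mono add_mono order_refl mult_left_mono power_mono) auto
    also have "\<dots> \<le> (real q)\<^sup>2 / 8" using bad_small by simp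
    finally show ?thesis .
  qed
  have b2: "real (card ?B2) \<le> (real q)\<^sup>2 / 8"
  proof -
    have "real (card ?B2) \<le> (\<Sum>v\<in>P. real (card (secants v U))) / K"
      by (rule card_exceeding_le) (use finite_points q K in auto)
    also have "\<dots> \<le> (real q * (real m)\<^sup>2 / 2) / K"
      by (rule divide_right_mono[OF sum_secants_le[OF finU U(2)]]) (simp add: K)
    also have "\<dots> = (real q)\<^sup>2 / 8" using q by (simp add: K power2_eq_square)
    finally show ?thesis .
  qed
  have b3: "real (card ?B3) \<le> (real q)\<^sup>2 / 4"
  proof -
    have "real (card ?B3) \<le> (\<Sum>v\<in>P. mean_secants v U) / (2 * (real s)\<^sup>2 / real q)"
      by (rule card_exceeding_le)
        (use finite_points q in \<open>auto simp: mean_secants_def intro!: divide_nonneg_nonneg sum_nonneg\<close>)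
    also have "\<dots> \<le> (real q * (real s)\<^sup>2 / 2) / (2 * (real s)\<^sup>2 / real q)"
      by (rule divide_right_mono[OF sum_mean_secants_le[OF finU caps]])
        (auto intro!: divide_nonneg_nonneg)
    also have "\<dots> = (real q)\<^sup>2 / 4" using q by (simp add: power2_eq_square)
    finally show ?thesis .
  qed
  show ?thesis using tot b0 b1 b2 b3 by linarith
qed

lemma \<eta>_bounds: "0 < \<eta>" "\<eta> \<le> 1"
  unfolding \<eta> by (simp_all add: powr_le1)

text \<open>A good point lowers the reciprocal of the number of caps by a factor at most 1 -
  \<eta>/2, any other point does not raise it, and a quarter of all points are good. Reciprocals are
  tracked because an upper bound on their sum limits how many sequences keep few caps.\<close>

lemma sum_inverse_step_le:
  assumes U: "U \<subseteq> P" "card U \<le> m" and tr: "real (card (triples U)) \<le> K * real m"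
    and caps: "\<And>I. I \<in> caps_in U \<Longrightarrow> card I \<le> s"
  shows "(\<Sum>v\<in>P. 1 / real (card (caps_in (if admissible K v U then insert v U else U))))
    \<le> (real q)\<^sup>2 * (1 - \<eta> / 8) * (1 / real (card (caps_in U)))"
proof -
  let ?G = "{v\<in>P. admissible K v U \<and> mean_secants v U \<le> 2 * (real s)\<^sup>2 / real q}"
  define N where "N = real (card (caps_in U))"
  have finU: "finite U" by (rule finite_subset[OF U(1) finite_points])
  have N: "N > 0" using caps_in_pos[OF finU] by (simp add: N_def)
  have le: "1 / real (card (caps_in (if admissible K v U then insert v U else U)))
      \<le> 1 / N - (if v \<in> ?G then \<eta> / 2 / N else 0)" for v
  proof (cases "v \<in> ?G")
    case True
    then have adm: "admissible K v U" and mean: "mean_secants v U \<le> 2 * (real s)\<^sup>2 / real q"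
      by simp_all
    have sep: "separating v U" using adm by (simp only: admissible_def)
    have "\<eta> \<le> (3/4) powr (4 * mean_secants v U)"
      unfolding \<eta> using mean by (intro powr_mono') simp_all
    then have "N * (1 + \<eta>) \<le> N * (1 + (3/4) powr (4 * mean_secants v U))"
      using N by (intro mult_left_mono) simp_all
    also have "\<dots> \<le> real (card (caps_in (insert v U)))"
      using card_caps_in_insert_ge[OF finU sep] by (simp only: N_def)
    finally have "1 / real (card (caps_in (insert v U))) \<le> 1 / (N * (1 + \<eta>))"
      using N \<eta>_bounds by (intro divide_left_mono) (auto simp: caps_in_pos finU)
    also have "\<dots> \<le> (1 - \<eta> / 2) / N"
    proof -
      \<comment> \<open>The product below equals 1 + (\<eta> - \<eta>^2)/2.\<close>
      have "\<eta> * \<eta> \<le> \<eta>" using \<eta>_bounds mult_left_mono[of \<eta> 1 \<eta>] by simp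
      then have "1 \<le> (1 - \<eta> / 2) * (1 + \<eta>)" by (simp add: algebra_simps)
      then have "1 / (1 + \<eta>) \<le> 1 - \<eta> / 2"
        using \<eta>_bounds by (subst pos_divide_le_eq) auto
      then have "1 / (1 + \<eta>) / N \<le> (1 - \<eta> / 2) / N"
        using N by (intro divide_right_mono) auto
      then show ?thesis by (simp add: mult.commute)
    qed
    finally have "1 / real (card (caps_in (insert v U))) \<le> 1 / N - \<eta> / 2 / N"
      by (simp only: diff_divide_distrib)
    then show ?thesis using True adm by simp
  next
    case False
    have "card (caps_in U) \<le> card (caps_in (if admissible K v U then insert v U else U))"
      by (intro card_mono finite_caps_in caps_in_mono) (auto simp: finU)
    then have "1 / real (card (caps_in (if admissible K v U then insert v U else U))) \<le> 1 / N"
      using N unfolding N_def by (intro divide_left_mono) (auto intro!: mult_pos_pos)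
    then show ?thesis using False by (simp only: if_False diff_0_right)
  qed
  have "(\<Sum>v\<in>P. 1 / real (card (caps_in (if admissible K v U then insert v U else U))))
      \<le> (\<Sum>v\<in>P. 1 / N - (if v \<in> ?G then \<eta> / 2 / N else 0))"
    by (rule sum_mono[OF le])
  also have "\<dots> = (real q)\<^sup>2 / N - real (card ?G) * (\<eta> / 2 / N)"
  proof -
    have "P \<inter> ?G = ?G" by auto
    then have "(\<Sum>v\<in>P. if v \<in> ?G then \<eta> / 2 / N else 0) = real (card ?G) * (\<eta> / 2 / N)"
      using finite_points by (simp only: sum.inter_restrict[symmetric] sum_constant)
    then show ?thesis by (simp only: sum_subtractf sum_constant) (simp add: card_points)
  qed
  also have "\<dots> \<le> (real q)\<^sup>2 / N - (real q)\<^sup>2 / 4 * (\<eta> / 2 / N)"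
    using card_good_points_ge[OF U tr caps] \<eta>_bounds N
    by (intro diff_left_mono mult_right_mono) auto
  also have "\<dots> = (real q)\<^sup>2 * (1 - \<eta> / 8) * (1 / N)"
    by (simp add: right_diff_distrib left_diff_distrib diff_divide_distrib)
  finally show ?thesis by (simp only: N_def)
qed

definition failing :: "nat \<Rightarrow> 'a list set" where
  "failing k = {vs. set vs \<subseteq> P \<and> length vs = k \<and> (\<forall>I\<in>caps_in (run K vs). card I \<le> s)}"

lemma finite_failing: "finite (failing k)"
  by (rule finite_subset[OF _ finite_lists_length_eq[OF finite_points, of k]])
    (auto simp: failing_def)

text \<open>The tail of a failing list is failing, as its run is smaller. So the one-step estimate
  applies at every stage; sums replace expectations, hence a factor \<open>q\<^sup>2\<close> per
  step.\<close>

lemma sum_inverse_failing_le: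
  assumes "k \<le> m"
  shows "(\<Sum>vs\<in>failing k. 1 / real (card (caps_in (run K vs))))
    \<le> ((real q)\<^sup>2 * (1 - \<eta> / 8)) ^ k"
  using assms
proof (induction k)
  case 0
  have "caps_in {} = {{}}" by (auto simp: caps_in_def cap_empty)
  moreover have "failing 0 \<subseteq> {[]}" by (auto simp: failing_def)
  then have "(\<Sum>vs\<in>failing 0. 1 / real (card (caps_in (run K vs))))
      \<le> (\<Sum>vs\<in>{[]}. 1 / real (card (caps_in (run K vs))))"
    by (intro sum_mono2) auto
  ultimately show ?case by simp
next
  case (Suc k)
  let ?w = "\<lambda>vs. 1 / real (card (caps_in (run K vs)))"
  have K0: "K \<ge> 0" by (simp add: K)
  have sub: "failing (Suc k) \<subseteq> (\<lambda>(vs, v). v # vs) ` (failing k \<times> P)"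
  proof
    fix ws assume ws: "ws \<in> failing (Suc k)"
    then obtain v vs where v: "ws = v # vs" by (cases ws) (auto simp: failing_def)
    have "run K vs \<subseteq> run K ws" by (auto simp: v)
    from caps_in_mono[OF this] have "vs \<in> failing k" using ws by (auto simp: failing_def v)
    moreover have "v \<in> P" using ws by (simp add: failing_def v)
    ultimately show "ws \<in> (\<lambda>(vs, v). v # vs) ` (failing k \<times> P)" by (force simp: v)
  qed
  have "(\<Sum>ws\<in>failing (Suc k). ?w ws) \<le> (\<Sum>ws\<in>(\<lambda>(vs, v). v # vs) ` (failing k \<times> P). ?w ws)"
    by (rule sum_mono2[OF _ sub]) (auto simp: finite_failing finite_points)
  also have "\<dots> = (\<Sum>(vs, v)\<in>failing k \<times> P. ?w (v # vs))"
    by (subst sum.reindex) (auto simp: inj_on_def case_prod_beta comp_def)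
  also have "\<dots> = (\<Sum>vs\<in>failing k. \<Sum>v\<in>P. ?w (v # vs))"
    by (rule sum.cartesian_product[symmetric])
  also have "\<dots> \<le> (\<Sum>vs\<in>failing k. (real q)\<^sup>2 * (1 - \<eta> / 8) * ?w vs)"
  proof (rule sum_mono)
    fix vs assume vs: "vs \<in> failing k"
    then have vP: "set vs \<subseteq> P" "length vs = k" by (auto simp: failing_def)
    have "run K vs \<subseteq> P" using run_subset vP(1) by (rule order_trans)
    moreover have "card (run K vs) \<le> m" using card_run_le[of K vs] vP(2) Suc.prems by simp
    moreover have "real (card (triples (run K vs))) \<le> K * real m"
    proof -
      have "K * real (length vs) \<le> K * real m" using K0 vP(2) Suc.prems by (intro mult_left_mono) auto
      then show ?thesis using card_triples_run_le[OF K0, of vs] by linarith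
    qed
    moreover have "card I \<le> s" if "I \<in> caps_in (run K vs)" for I
      using vs that by (simp add: failing_def)
    ultimately show "(\<Sum>v\<in>P. ?w (v # vs)) \<le> (real q)\<^sup>2 * (1 - \<eta> / 8) * ?w vs"
      using sum_inverse_step_le[of "run K vs"] by simp
  qed
  also have "\<dots> = (real q)\<^sup>2 * (1 - \<eta> / 8) * (\<Sum>vs\<in>failing k. ?w vs)"
    by (simp only: sum_distrib_left)
  also have "\<dots> \<le> (real q)\<^sup>2 * (1 - \<eta> / 8) * ((real q)\<^sup>2 * (1 - \<eta> / 8)) ^ k"
    using Suc \<eta>_bounds by (intro mult_left_mono) auto
  finally show ?case by simp
qed

text \<open>At the end of a failing list all caps have at most \<open>s\<close> points, so there are
  at most (m + 1)^s of them and the reciprocal cannot be small.\<close>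

lemma card_failing_le:
  "real (card (failing m)) \<le> real (m + 1) ^ s * ((real q)\<^sup>2 * (1 - \<eta> / 8)) ^ m"
proof -
  have le: "1 \<le> real (m + 1) ^ s * (1 / real (card (caps_in (run K vs))))" if vs: "vs \<in> failing m" for vs
  proof -
    have "caps_in (run K vs) \<subseteq> {I. I \<subseteq> run K vs \<and> card I \<le> s}"
      using vs by (auto simp: failing_def caps_in_def)
    moreover have "finite {I. I \<subseteq> run K vs \<and> card I \<le> s}"
      by (rule finite_subset[of _ "Pow (run K vs)"]) (auto simp: finite_run)
    ultimately have "card (caps_in (run K vs)) \<le> card {I. I \<subseteq> run K vs \<and> card I \<le> s}"
      by (intro card_mono)
    also have "\<dots> \<le> (card (run K vs) + 1) ^ s" by (rule card_small_subsets_le[OF finite_run])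
    also have "\<dots> \<le> (m + 1) ^ s"
      using card_run_le[of K vs] vs by (intro power_mono) (auto simp: failing_def)
    finally have "real (card (caps_in (run K vs))) \<le> real ((m + 1) ^ s)"
      by (simp only: of_nat_le_iff)
    moreover have "0 < real (card (caps_in (run K vs)))" using caps_in_pos[OF finite_run] by simp
    ultimately show ?thesis by (simp add: pos_le_divide_eq)
  qed
  have "real (card (failing m)) = (\<Sum>vs\<in>failing m. 1)" by simp
  also have "\<dots> \<le> (\<Sum>vs\<in>failing m. real (m + 1) ^ s * (1 / real (card (caps_in (run K vs)))))"
    by (rule sum_mono[OF le])
  also have "\<dots> = real (m + 1) ^ s * (\<Sum>vs\<in>failing m. 1 / real (card (caps_in (run K vs))))"
    by (simp only: sum_distrib_left)
  also have "\<dots> \<le> real (m + 1) ^ s * ((real q)\<^sup>2 * (1 - \<eta> / 8)) ^ m"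
    by (intro mult_left_mono sum_inverse_failing_le) simp_all
  finally show ?thesis .
qed

text \<open>At most half of the sequences fail. Each other one contains a cap of exactly
  \<open>s + 1\<close> points, while a fixed such cap lies in a fraction of at most (m/q^2)^(s+1) of
  all sequences.\<close>

lemma num_caps_ge:
  assumes small: "real (m + 1) ^ s * (1 - \<eta> / 8) ^ m \<le> 1 / 2"
  shows "real (num_caps P L) \<ge> ((real q)\<^sup>2 / real m) ^ (s + 1) / 2"
proof -
  define n where "n = card P"
  define C where "C = {J. cap P L J \<and> card J = s + 1}"
  let ?S = "\<lambda>J. {vs. set vs \<subseteq> P \<and> length vs = m \<and> J \<subseteq> set vs}"
  have n: "real n = (real q)\<^sup>2" "n > 0" using pos by (simp_all add: n_def card_points)
  have finA: "finite {vs. set vs \<subseteq> P \<and> length vs = m}"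
    by (rule finite_lists_length_eq[OF finite_points])
  have finC: "finite C"
    by (rule finite_subset[of _ "Pow P"]) (auto simp: C_def cap_def finite_points)
  have finS: "finite (?S J)" for J by (rule finite_subset[OF _ finA]) auto
  have "{vs. set vs \<subseteq> P \<and> length vs = m} \<subseteq> failing m \<union> (\<Union>J\<in>C. ?S J)"
  proof
    fix vs assume vs: "vs \<in> {vs. set vs \<subseteq> P \<and> length vs = m}"
    show "vs \<in> failing m \<union> (\<Union>J\<in>C. ?S J)"
    proof (cases "vs \<in> failing m")
      case False
      then obtain I where I: "I \<in> caps_in (run K vs)" "s + 1 \<le> card I"
        using vs by (auto simp: failing_def not_le)
      obtain J where J: "J \<subseteq> I" "card J = s + 1" using obtain_subset_with_card_n[OF I(2)] by metis
      have cap: "cap P L I" and sub: "I \<subseteq> run K vs" using I(1) by (simp_all add: caps_in_def)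
      have "J \<in> C" using cap_mono[OF cap J(1)] J(2) by (simp add: C_def)
      moreover have "J \<subseteq> set vs" using J(1) sub run_subset[of K vs] by simp
      ultimately show ?thesis using vs by auto
    qed simp
  qed
  then have "card {vs. set vs \<subseteq> P \<and> length vs = m} \<le> card (failing m \<union> (\<Union>J\<in>C. ?S J))"
    using finS finC finite_failing by (intro card_mono) auto
  also have "\<dots> \<le> card (failing m) + card (\<Union>J\<in>C. ?S J)" by (rule card_Un_le)
  also have "\<dots> \<le> card (failing m) + (\<Sum>J\<in>C. card (?S J))"
    by (rule add_left_mono[OF card_UN_le[OF finC]])
  finally have "n ^ m \<le> card (failing m) + (\<Sum>J\<in>C. card (?S J))"
    by (simp only: card_lists_length_eq[OF finite_points] n_def)
  then have "real (n ^ m) \<le> real (card (failing m) + (\<Sum>J\<in>C. card (?S J)))"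
    by (simp only: of_nat_le_iff)
  then have tot: "real n ^ m \<le> real (card (failing m)) + (\<Sum>J\<in>C. real (card (?S J)))"
    by simp
  have "real (card (failing m)) \<le> real n ^ m * (real (m + 1) ^ s * (1 - \<eta> / 8) ^ m)"
    using card_failing_le by (simp only: n power_mult_distrib mult.left_commute)
  also have "\<dots> \<le> real n ^ m * (1 / 2)" by (rule mult_left_mono[OF small]) simp
  finally have half: "real (card (failing m)) \<le> real n ^ m / 2" by simp
  have each: "real (card (?S J)) \<le> (real m / real n) ^ (s + 1) * real n ^ m" if J: "J \<in> C" for J
  proof -
    have JP: "J \<subseteq> P" "card J = s + 1" using J by (simp_all add: C_def cap_def)
    have "real (card (?S J) * card P ^ card J) \<le> real (m ^ card J * card P ^ m)"
      using card_lists_containing_le[OF finite_points finite_subset[OF JP(1) finite_points] JP(1), of m]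
      by (simp only: of_nat_le_iff)
    then have "real (card (?S J)) * real n ^ (s + 1) \<le> real m ^ (s + 1) * real n ^ m"
      by (simp only: JP(2) n_def of_nat_mult of_nat_power)
    then have "real (card (?S J)) \<le> real m ^ (s + 1) * real n ^ m / real n ^ (s + 1)"
      using n by (subst pos_le_divide_eq) simp_all
    then show ?thesis by (simp only: power_divide) simp
  qed
  have "real n ^ m / 2 \<le> (\<Sum>J\<in>C. real (card (?S J)))" using tot half by simp
  also have "\<dots> \<le> (\<Sum>J\<in>C. (real m / real n) ^ (s + 1) * real n ^ m)" by (rule sum_mono[OF each])
  also have "\<dots> = (real (card C) * (real m / real n) ^ (s + 1)) * real n ^ m" by simp
  finally have "(1 / 2) * real n ^ m \<le> (real (card C) * (real m / real n) ^ (s + 1)) * real n ^ m"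
    by simp
  then have "1 / 2 \<le> real (card C) * (real m / real n) ^ (s + 1)"
    by (rule mult_right_le_imp_le) (use n in simp)
  then have "1 / 2 * (real n / real m) ^ (s + 1)
      \<le> real (card C) * (real m / real n) ^ (s + 1) * (real n / real m) ^ (s + 1)"
    by (rule mult_right_mono) simp
  also have "\<dots> = real (card C) * ((real m / real n) * (real n / real m)) ^ (s + 1)"
    by (simp only: power_mult_distrib mult.assoc)
  also have "\<dots> = real (card C)" using pos n(2) by simp
  also have "\<dots> \<le> real (num_caps P L)"
  proof -
    have "finite {S. cap P L S}"
      by (rule finite_subset[of _ "Pow P"]) (auto simp: cap_def finite_points)
    then have "card C \<le> card {S. cap P L S}" by (rule card_mono) (auto simp: C_def)
    then show ?thesis by (simp add: num_caps_def)
  qed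
  finally show ?thesis by (simp only: n(1))
qed

end

end

section \<open>Choice of parameters for the lower bound\<close>

lemma num_caps_lower:
  "eventually (\<lambda>q. \<forall>(P :: 'a set) L. affine_plane_of_order P L q \<longrightarrow>
     2 powr (1/20 * real q powr (1/2) * (log 2 (real q)) powr (3/2)) < real (num_caps P L)) sequentially"
proof -
  have ev1: "eventually (\<lambda>q::nat. 1 \<le> sqrt (q * ln q) / 10) sequentially" by real_asymp
  have ev2: "eventually (\<lambda>q::nat. 4 \<le> q powr (3/5)) sequentially" by real_asymp
  have ev3: "eventually (\<lambda>q::nat. q powr (3/5) / 4 + 1 \<le> q) sequentially" by real_asymp
  \<comment> \<open>The decisive comparison: s ln q is of order q^(1/2) up to logarithms, while m
    \<eta> is at least of order q^(0.57).\<close>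
  have ev4: "eventually (\<lambda>q::nat. sqrt (q * ln q) / 10 * ln q + 1
      \<le> (q powr (3/5) / 4 - 1) * (real q powr (-0.03) / 8)) sequentially" by real_asymp
  show ?thesis
    using ev1 ev2 ev3 ev4 eventually_ge_at_top[of 4]
  proof eventually_elim
    case (elim q)
    show ?case
    proof (intro allI impI)
      fix P :: "'a set" and L
      assume "affine_plane_of_order P L q"
      then interpret affine_plane_of_order P L q .
      \<comment> \<open>The exponent 3/5 makes m^5/q of order q^2, the most that
        \<open>bad_small\<close> tolerates.\<close>
      define M where "M = real q powr (3/5)"
      define S where "S = sqrt (q * ln q) / 10"
      define m where "m = nat \<lfloor>M / 4\<rfloor>"
      define s where "s = nat \<lfloor>S\<rfloor>"
      define K where "K = 4 * (real m)\<^sup>2 / real q"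
      define \<eta> where "\<eta> = (3/4 :: real) powr (8 * (real s)\<^sup>2 / real q)"
      have q: "real q \<ge> 4" using elim by simp
      have lnq: "ln (real q) \<ge> 0" using q by simp
      have S1: "1 \<le> S" and M4: "4 \<le> M" and M1: "M / 4 + 1 \<le> q"
        and key: "S * ln q + 1 \<le> (M / 4 - 1) * (real q powr (-0.03) / 8)"
        using elim by (simp_all only: S_def M_def)
      have m: "real m \<le> M / 4" "M / 4 - 1 \<le> real m" "0 < m"
        using M4 unfolding m_def by linarith+
      have s: "real s \<le> S" "S \<le> real (s + 1)" "0 < s"
        using S1 unfolding s_def by linarith+
      have M5: "M ^ 5 = real q ^ 3"
        using q by (simp add: M_def powr_power)
      have Mq: "M \<le> real q"
        using q powr_mono[of "3/5" 1 "real q"] by (simp add: M_def)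
      have m_small: "8 * real m \<le> (real q)\<^sup>2"
      proof -
        have "2 * real q \<le> real q * real q" using q by (intro mult_right_mono) auto
        then show ?thesis using m(1) Mq by (simp add: power2_eq_square)
      qed
      have bad_small: "8 * (K * real m * (real q + 9 * (real m)\<^sup>2)) \<le> (real q)\<^sup>2"
      proof -
        have "real m ^ 3 \<le> (M / 4) ^ 3" using m(1) by (intro power_mono) auto
        also have "\<dots> \<le> M ^ 3 / 64" by (simp add: power_divide)
        also have "M ^ 3 \<le> real q ^ 2"
          using q powr_mono[of "9/5" 2 "real q"] by (simp add: M_def powr_power)
        finally have m3: "real m ^ 3 \<le> (real q)\<^sup>2 / 64" by simp
        have "real m ^ 5 \<le> (M / 4) ^ 5" using m(1) by (intro power_mono) auto
        also have "\<dots> = real q ^ 3 / 1024" by (simp add: power_divide M5)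
        finally have "real m ^ 5 / real q \<le> real q ^ 3 / 1024 / real q"
          by (intro divide_right_mono) auto
        also have "\<dots> = (real q)\<^sup>2 / 1024" using q by (simp add: power2_eq_square power3_eq_cube)
        finally have m5: "real m ^ 5 / real q \<le> (real q)\<^sup>2 / 1024" .
        have "8 * (K * real m * (real q + 9 * (real m)\<^sup>2))
            = 32 * real m ^ 3 * (real q / real q) + 288 * (real m ^ 5 / real q)"
          by (simp add: K_def distrib_left add_divide_distrib)
            (simp add: power2_eq_square power3_eq_cube eval_nat_numeral)
        also have "\<dots> = 32 * real m ^ 3 + 288 * (real m ^ 5 / real q)" using q by simp
        also have "\<dots> \<le> (real q)\<^sup>2"
          \<comment> \<open>The coefficients are 32/64 + 288/1024 < 1.\<close>
          using m3 m5 zero_le_power2[of "real q"] by linarith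
        finally show ?thesis .
      qed
      \<comment> \<open>The 1/10 in \<open>S\<close> makes the exponent in \<open>\<eta>\<close> at
        most 0.08 ln q, and ln (4/3) <= 1/3 turns this into a power of q of exponent at least
        -0.08/3 > -0.03.\<close>
      have \<eta>_ge: "real q powr (-0.03) \<le> \<eta>"
      proof -
        have "(real s)\<^sup>2 \<le> S\<^sup>2" using s(1) by (intro power_mono) auto
        also have "\<dots> = real q * ln q / 100" using lnq by (simp add: S_def power_divide)
        finally have "8 * (real s)\<^sup>2 / real q \<le> 8 * (real q * ln q / 100) / real q"
          by (intro divide_right_mono) auto
        then have e: "8 * (real s)\<^sup>2 / real q \<le> 0.08 * ln q" using q by simp
        have "ln (4/3 :: real) \<le> 1/3" using ln_le_minus_one[of "4/3 :: real"] by simp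
        then have l: "ln (3/4 :: real) \<ge> - (1/3)" by (simp add: ln_div)
        have "(-0.03) * ln q \<le> 0.08 * ln q * (- (1/3))" using lnq by simp
        also have "\<dots> \<le> 8 * (real s)\<^sup>2 / real q * (- (1/3))"
          using e by (intro mult_right_mono_neg) simp_all
        also have "\<dots> \<le> 8 * (real s)\<^sup>2 / real q * ln (3/4)"
          using l by (intro mult_left_mono) simp_all
        finally show ?thesis using q by (simp add: \<eta>_def powr_def)
      qed
      have \<eta>01: "0 < \<eta>" "\<eta> \<le> 1" by (simp_all add: \<eta>_def powr_le1)
      have small: "real (m + 1) ^ s * (1 - \<eta> / 8) ^ m \<le> 1 / 2"
      proof -
        have "real (m + 1) ^ s \<le> real q ^ s" using m(1) M1 by (intro power_mono) auto
        also have "\<dots> = exp (real s * ln q)" using q by (simp add: exp_of_nat_mult)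
        also have "\<dots> \<le> exp (S * ln q)" using s(1) lnq by (simp add: mult_right_mono)
        finally have 1: "real (m + 1) ^ s \<le> exp (S * ln q)" .
        have "(1 - \<eta> / 8) ^ m \<le> exp (- \<eta> / 8) ^ m"
          using \<eta>01 exp_ge_add_one_self[of "- \<eta> / 8"] by (intro power_mono) auto
        also have "\<dots> = exp (- (real m * (\<eta> / 8)))" by (simp flip: exp_of_nat_mult)
        also have "\<dots> \<le> exp (- (S * ln q + 1))"
        proof -
          have "(M / 4 - 1) * (real q powr (-0.03) / 8) \<le> real m * (\<eta> / 8)"
            using m \<eta>_ge by (intro mult_mono) auto
          then show ?thesis using key by simp
        qed
        finally have 2: "(1 - \<eta> / 8) ^ m \<le> exp (- (S * ln q + 1))" .
        have "real (m + 1) ^ s * (1 - \<eta> / 8) ^ m \<le> exp (S * ln q) * exp (- (S * ln q + 1))"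
          using 1 2 \<eta>01 by (intro mult_mono) auto
        also have "\<dots> = 1 / exp 1" by (simp add: exp_minus field_simps flip: exp_add)
        \<comment> \<open>The summand 1 in \<open>key\<close> pays for the factor 1/2, since e >=
          2.\<close>
        also have "\<dots> \<le> 1 / 2" using exp_ge_add_one_self[of 1] by (intro divide_left_mono) auto
        finally show ?thesis .
      qed
      have "q > 0" using elim by simp
      from num_caps_ge[OF this m(3) s(3) K_def \<eta>_def m_small bad_small small]
      have ge: "((real q)\<^sup>2 / real m) ^ (s + 1) / 2 \<le> real (num_caps P L)" .
      have "4 * real q \<le> (real q)\<^sup>2 / real m"
      proof -
        have "4 * real m * real q \<le> real q * real q" using m(1) Mq by (intro mult_right_mono) auto
        then show ?thesis using m(3) by (simp add: pos_le_divide_eq power2_eq_square mult_ac)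
      qed
      then have "(4 * real q) ^ (s + 1) \<le> ((real q)\<^sup>2 / real m) ^ (s + 1)"
        by (intro power_mono) auto
      \<comment> \<open>The spare factor 4, from \<open>m\<close> being at most q/4, absorbs the
        division by 2 and makes the inequality strict.\<close>
      moreover have "4 * real q ^ (s + 1) \<le> (4 * real q) ^ (s + 1)"
      proof -
        have "(4::real) ^ 1 \<le> 4 ^ (s + 1)" by (intro power_increasing) auto
        then show ?thesis by (simp only: power_mult_distrib) (intro mult_right_mono, auto)
      qed
      moreover have "0 < real q ^ (s + 1)" using q by simp
      ultimately have gt: "real q ^ (s + 1) < real (num_caps P L)" using ge by linarith
      \<comment> \<open>The constant 1/20 is the 1/10 of \<open>S\<close> halved by passing from ln
        to log 2: as ln 2 >= 1/4, the square root loses a factor of at most 2.\<close>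
      have "1/20 * real q powr (1/2) * (log 2 (real q)) powr (3/2) \<le> real (s + 1) * log 2 (real q)"
      proof -
        define l where "l = log 2 (real q)"
        have l: "l > 0" using q by (simp add: l_def)
        have "ln (1/2 :: real) \<le> - (1/2)" using ln_le_minus_one[of "1/2 :: real"] by simp
        then have "ln (2::real) \<ge> 1/4" by (simp add: ln_div)
        then have "ln q \<ge> 1/4 * l"
          using l mult_right_mono[of "1/4" "ln 2" l] by (simp add: l_def log_def)
        then have "sqrt (1/4 * l) \<le> sqrt (ln q)" by simp
        then have sl: "sqrt l / 2 \<le> sqrt (ln q)" by (simp add: real_sqrt_mult real_sqrt_divide)
        have "l powr (3/2) = l powr (1 + 1/2)" by simp
        also have "\<dots> = l * sqrt l" using l by (simp only: powr_add powr_half_sqrt powr_one less_imp_le)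
        finally have "1/20 * real q powr (1/2) * l powr (3/2) = sqrt q * (sqrt l / 2) / 10 * l"
          by (simp add: powr_half_sqrt)
        also have "\<dots> \<le> sqrt q * sqrt (ln q) / 10 * l"
          using sl l by (intro mult_right_mono divide_right_mono mult_left_mono) auto
        also have "\<dots> = S * l" by (simp add: S_def real_sqrt_mult)
        also have "\<dots> \<le> real (s + 1) * l" using s(2) l by (intro mult_right_mono) auto
        finally show ?thesis by (simp only: l_def)
      qed
      then have "2 powr (1/20 * real q powr (1/2) * (log 2 (real q)) powr (3/2))
          \<le> 2 powr (real (s + 1) * log 2 (real q))" by simp
      also have "\<dots> = (2 powr log 2 (real q)) powr real (s + 1)"
        by (simp only: powr_powr mult.commute)
      also have "\<dots> = real q ^ (s + 1)" using q by (simp add: powr_realpow del: of_nat_Suc of_nat_add)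
      finally show "2 powr (1/20 * real q powr (1/2) * (log 2 (real q)) powr (3/2))
          < real (num_caps P L)" using gt by linarith
    qed
  qed
qed

theorem theorem3:
  shows "\<exists>c :: real. c > 0 \<and> (\<exists>q0 :: nat. \<forall>q \<ge> q0.
    (\<exists>(P :: nat set) L. affine_plane_of_order P L q) \<longrightarrow>
      2 powr (c * real q powr (1/2) * (log 2 (real q)) powr (3/2)) < real (max_caps q) \<and>
      real (max_caps q) < 2 powr (6 * real q))"
proof -
  obtain q1 where low: "\<And>q (P :: nat set) L. q \<ge> q1 \<Longrightarrow> affine_plane_of_order P L q \<Longrightarrow>
      2 powr (1/20 * real q powr (1/2) * (log 2 (real q)) powr (3/2)) < real (num_caps P L)"
    using num_caps_lower[where 'a = nat] unfolding eventually_sequentially by metis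
  obtain q2 where up: "\<And>q (P :: nat set) L. q \<ge> q2 \<Longrightarrow> affine_plane_of_order P L q \<Longrightarrow>
      real (num_caps P L) < 2 powr (6 * real q)"
    using num_caps_upper[where 'a = nat] unfolding eventually_sequentially by metis
  have "2 powr (1/20 * real q powr (1/2) * (log 2 (real q)) powr (3/2)) < real (max_caps q) \<and>
      real (max_caps q) < 2 powr (6 * real q)"
    if q: "q \<ge> max q1 q2" and ex: "\<exists>(P :: nat set) L. affine_plane_of_order P L q" for q
  proof
    obtain P :: "nat set" and L where pl: "affine_plane_of_order P L q" using ex by blast
    have "real (num_caps P L) \<le> real (max_caps q)" using num_caps_le_max_caps[OF pl] by simp
    then show "2 powr (1/20 * real q powr (1/2) * (log 2 (real q)) powr (3/2)) < real (max_caps q)"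
      using low[OF _ pl] q by simp
    \<comment> \<open>A plane exists, so the maximum is over a finite nonempty set and is attained
      by some plane, to which the upper bound applies.\<close>
    have "max_caps q \<in> {num_caps P L | (P :: nat set) L. affine_plane_of_order P L q}"
      unfolding max_caps_def by (rule Max_in[OF finite_num_caps]) (use pl in blast)
    then obtain P' :: "nat set" and L' where pl': "affine_plane_of_order P' L' q"
      and eq: "max_caps q = num_caps P' L'" by blast
    show "real (max_caps q) < 2 powr (6 * real q)" unfolding eq using up[OF _ pl'] q by simp
  qed
  then show ?thesis by (intro exI[of _ "1/20"] conjI exI[of _ "max q1 q2"] allI impI) simp_all
qed

end
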